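(* Let $\Lambda$ be one of the grid graphs $T_{K,L}$, $G_{K,L}$, $C_{K,L}$ (with the parity requirements below), and consider the hard-core Metropolis Markov chain $\{X^\beta_t\}_{t\in\mathbb N}$ on $\Lambda$. There exists a constant $\Gamma(\Lambda)>0$ such that (i) for every $\varepsilon>0$, $\lim_{\beta\to\infty}\mathbb P\big(e^{\beta(\Gamma(\Lambda)-\varepsilon)}<\tau^{\mathbf e}_{\mathbf o}<e^{\beta(\Gamma(\Lambda)+\varepsilon)}\big)=1$; (ii) $\lim_{\beta\to\infty}\frac1\beta\log\mathbb E\,\tau^{\mathbf e}_{\mathbf o}=\Gamma(\Lambda)$; (iii) $\tau^{\mathbf e}_{\mathbf o}/\mathbb E\,\tau^{\mathbf e}_{\mathbf o}$ converges in distribution, as $\beta\to\infty$, to an exponential random variable with mean $1$. Moreover, if $\Lambda=G_{K,L}$ with $KL$ odd, then (i), (ii), (iii) also hold for the hitting time $\tau^{\mathbf o}_{\mathbf e}$ in place of $\tau^{\mathbf e}_{\mathbf o}$, with $\Gamma(\Lambda)$ replaced by $\Gamma(\Lambda)-1$.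
   Context: Grids: for integers $K,L\ge 2$, the site set is $\Lambda=\{(v_1,v_2):0\le v_1\le L-1,\ 0\le v_2\le K-1\}$ ($N=KL$ sites). In the open grid $G_{K,L}$, $v,w$ are adjacent iff $|v_1-w_1|+|v_2-w_2|=1$. The cylindrical grid $C_{K,L}$ (with $K$ even) has in addition the edges $(j,0)\sim(j,K-1)$ for all $j$. The toric grid $T_{K,L}$ (with $K$ and $L$ both even) has in addition to the cylindrical edges the edges $(0,i)\sim(L-1,i)$ for all $i$. A site is even if $v_1+v_2$ is even and odd otherwise; $V_e,V_o$ denote the sets of even and odd sites. Hard-core chain: the state space $\mathcal X$ is the set of $\sigma\in\{0,1\}^\Lambda$ with $\sigma(v)\sigma(w)=0$ for all adjacent $v,w$; $H(\sigma)=-\sum_{v}\sigma(v)$; $q(\sigma,\sigma')=1/N$ if $\sigma,\sigma'$ differ in exactly one site, $q(\sigma,\sigma')=0$ if they differ in more than one site, and $q(\sigma,\sigma)=1-\sum_{\eta\ne\sigma}q(\sigma,\eta)$. For $\beta>0$ the chain has transition probabilities $P_\beta(\sigma,\sigma')=q(\sigma,\sigma')e^{-\beta[H(\sigma')-H(\sigma)]^+}$ for $\sigma\ne\sigma'$ and $P_\beta(\sigma,\sigma)=1-\sum_{\sigma'\ne\sigma}P_\beta(\sigma,\sigma')$. $\mathbf e$ (resp. $\mathbf o$) is the configuration with particles exactly at the even (resp. odd) sites. For a state $x$ and set $A$, $\tau^x_A=\inf\{t>0:X^\beta_t\in A\}$ for the chain started at $X_0=x$; $\tau^x_y=\tau^x_{\{y\}}$.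 *)

theory Defs
  imports "HOL-Analysis.Analysis"
begin

datatype grid_kind = OpenGrid | CylGrid | TorusGrid

definition sites :: "nat \<Rightarrow> nat \<Rightarrow> (nat \<times> nat) set" where
  "sites K L = {(v1, v2). v1 < L \<and> v2 < K}"

definition open_adj :: "nat \<times> nat \<Rightarrow> nat \<times> nat \<Rightarrow> bool" where
  "open_adj v w \<longleftrightarrow>
     \<bar>int (fst v) - int (fst w)\<bar> + \<bar>int (snd v) - int (snd w)\<bar> = 1"

definition cyl_edge :: "nat \<Rightarrow> nat \<times> nat \<Rightarrow> nat \<times> nat \<Rightarrow> bool" where
  "cyl_edge K v w \<longleftrightarrow> fst v = fst w \<and> {snd v, snd w} = {0, K - 1}"

definition tor_edge :: "nat \<Rightarrow> nat \<times> nat \<Rightarrow> nat \<times> nat \<Rightarrow> bool" where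
  "tor_edge L v w \<longleftrightarrow> snd v = snd w \<and> {fst v, fst w} = {0, L - 1}"

fun adj :: "grid_kind \<Rightarrow> nat \<Rightarrow> nat \<Rightarrow> nat \<times> nat \<Rightarrow> nat \<times> nat \<Rightarrow> bool" where
  "adj OpenGrid K L v w = open_adj v w"
| "adj CylGrid K L v w = (open_adj v w \<or> cyl_edge K v w)"
| "adj TorusGrid K L v w = (open_adj v w \<or> cyl_edge K v w \<or> tor_edge L v w)"

fun valid_grid :: "grid_kind \<Rightarrow> nat \<Rightarrow> nat \<Rightarrow> bool" where
  "valid_grid OpenGrid K L = (2 \<le> K \<and> 2 \<le> L)"
| "valid_grid CylGrid K L = (2 \<le> K \<and> 2 \<le> L \<and> even K)"
| "valid_grid TorusGrid K L = (2 \<le> K \<and> 2 \<le> L \<and> even K \<and> even L)"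

text \<open>A configuration sigma in {0,1}^Lambda is identified with its set of occupied sites.\<close>
definition hc_states :: "grid_kind \<Rightarrow> nat \<Rightarrow> nat \<Rightarrow> (nat \<times> nat) set set" where
  "hc_states g K L =
     {S. S \<subseteq> sites K L \<and> (\<forall>v\<in>S. \<forall>w\<in>S. \<not> adj g K L v w)}"

definition hc_H :: "(nat \<times> nat) set \<Rightarrow> real" where
  "hc_H S = - real (card S)"

definition conf_e :: "nat \<Rightarrow> nat \<Rightarrow> (nat \<times> nat) set" where
  "conf_e K L = {v \<in> sites K L. even (fst v + snd v)}"

definition conf_o :: "nat \<Rightarrow> nat \<Rightarrow> (nat \<times> nat) set" where
  "conf_o K L = {v \<in> sites K L. odd (fst v + snd v)}"

text \<open>Proposal kernel q (for distinct configurations).\<close>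
definition hc_q :: "nat \<Rightarrow> nat \<Rightarrow> (nat \<times> nat) set \<Rightarrow> (nat \<times> nat) set \<Rightarrow> real" where
  "hc_q K L S S' = (if card ((S - S') \<union> (S' - S)) = 1 then 1 / real (K * L) else 0)"

definition hc_Poff :: "nat \<Rightarrow> nat \<Rightarrow> real \<Rightarrow> (nat \<times> nat) set \<Rightarrow> (nat \<times> nat) set \<Rightarrow> real" where
  "hc_Poff K L \<beta> S S' = hc_q K L S S' * exp (- \<beta> * max 0 (hc_H S' - hc_H S))"

definition hc_P :: "grid_kind \<Rightarrow> nat \<Rightarrow> nat \<Rightarrow> real \<Rightarrow> (nat \<times> nat) set \<Rightarrow> (nat \<times> nat) set \<Rightarrow> real" where
  "hc_P g K L \<beta> S S' =
     (if S' = S then 1 - (\<Sum>S''\<in>hc_states g K L - {S}. hc_Poff K L \<beta> S S'')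
      else hc_Poff K L \<beta> S S')"

text \<open>For a chain with transition matrix P on finite state space X and target set A,
  surv P X A n x = Prob(tau^x_A > n), where tau^x_A = inf {t > 0. X_t \<in> A}, X_0 = x.\<close>
fun surv :: "('s \<Rightarrow> 's \<Rightarrow> real) \<Rightarrow> 's set \<Rightarrow> 's set \<Rightarrow> nat \<Rightarrow> 's \<Rightarrow> real" where
  "surv P X A 0 x = 1"
| "surv P X A (Suc n) x = (\<Sum>y\<in>X. P x y * (if y \<in> A then 0 else surv P X A n y))"

definition hit_pmf :: "('s \<Rightarrow> 's \<Rightarrow> real) \<Rightarrow> 's set \<Rightarrow> 's set \<Rightarrow> 's \<Rightarrow> nat \<Rightarrow> real" where
  "hit_pmf P X A x t = (if t = 0 then 0 else surv P X A (t - 1) x - surv P X A t x)"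

definition hit_prob_between :: "('s \<Rightarrow> 's \<Rightarrow> real) \<Rightarrow> 's set \<Rightarrow> 's set \<Rightarrow> 's \<Rightarrow> real \<Rightarrow> real \<Rightarrow> real" where
  "hit_prob_between P X A x a b =
     (\<Sum>t\<in>{t::nat. a < real t \<and> real t < b}. hit_pmf P X A x t)"

text \<open>E tau^x_A (meaningful when the series is summable).\<close>
definition hit_mean :: "('s \<Rightarrow> 's \<Rightarrow> real) \<Rightarrow> 's set \<Rightarrow> 's set \<Rightarrow> 's \<Rightarrow> real" where
  "hit_mean P X A x = (\<Sum>t. real t * hit_pmf P X A x t)"

definition hit_scaled_cdf :: "('s \<Rightarrow> 's \<Rightarrow> real) \<Rightarrow> 's set \<Rightarrow> 's set \<Rightarrow> 's \<Rightarrow> real \<Rightarrow> real" where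
  "hit_scaled_cdf P X A x s =
     (\<Sum>t\<in>{t::nat. real t / hit_mean P X A x \<le> s}. hit_pmf P X A x t)"

definition exp1_cdf :: "real \<Rightarrow> real" where
  "exp1_cdf s = (if s < 0 then 0 else 1 - exp (- s))"

definition metastable_props ::
  "(real \<Rightarrow> 's \<Rightarrow> 's \<Rightarrow> real) \<Rightarrow> 's set \<Rightarrow> 's \<Rightarrow> 's \<Rightarrow> real \<Rightarrow> bool" where
  "metastable_props P X x y Gam \<longleftrightarrow>
     (\<forall>\<beta>>0. summable (\<lambda>t. real t * hit_pmf (P \<beta>) X {y} x t)) \<and>
     (\<forall>\<epsilon>>0. ((\<lambda>\<beta>. hit_prob_between (P \<beta>) X {y} x
                         (exp (\<beta> * (Gam - \<epsilon>))) (exp (\<beta> * (Gam + \<epsilon>))))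
                \<longlongrightarrow> 1) at_top) \<and>
     ((\<lambda>\<beta>. ln (hit_mean (P \<beta>) X {y} x) / \<beta>) \<longlongrightarrow> Gam) at_top \<and>
     (\<forall>s. ((\<lambda>\<beta>. hit_scaled_cdf (P \<beta>) X {y} x s) \<longlongrightarrow> exp1_cdf s) at_top)"

end

theory Submission
  imports Defs "HOL-Real_Asymp.Real_Asymp"
begin

text \<open>
  Let \<open>\<Gamma>\<close> be the energy barrier between \<open>e\<close> and \<open>o\<close>, seen from the starting configuration.
  Bounding Green functions through the Dirichlet form shows that the expected hitting time is at most
  of order \<open>exp (\<beta> \<Gamma>)\<close>, and reversibility bounds the flow out of the starting well from above,
  so that it is at least of this order. If every other configuration lies in a strictly shallower
  well, the chain forgets its position on a negligible time scale, and the exponential law follows.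

  The value of \<open>\<Gamma>\<close> is never computed. Every even site has more than \<open>d\<close> neighbours, hence removing
  \<open>d\<close> particles from \<open>o\<close> makes no room for an even particle and \<open>\<Gamma> > d\<close>; here \<open>d\<close> is 2 on the torus
  (unless \<open>K = L = 2\<close>) and 1 otherwise. On the other hand every configuration other than \<open>e\<close> and \<open>o\<close> has depth at most
  \<open>d\<close>. Moving particles by swaps leads from a deeper configuration to a nonempty even set \<open>A\<close> and a
  nonempty odd set \<open>B\<close>, without contact, such that no site has exactly one neighbour in \<open>A\<close> or exactly
  one in \<open>B\<close>. A closest pair of points of \<open>A\<close> and \<open>B\<close> can then be shifted diagonally for ever. This
  is absurd if there is a boundary; on the torus the whole diagonal closes up and can be swapped
  starting from a single removal.
\<close>

section \<open>Hitting times of finite Markov chains\<close>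

text \<open>A single integer \<open>m\<close> describes the barrier in both directions: the largest
  particle number that can be maintained along a path between \<open>o\<close> and \<open>e\<close>.
  Seen from \<open>x\<close> the barrier is \<open>card x - m\<close>; for odd \<open>K * L\<close>
  the configuration \<open>e\<close> has one particle more than \<open>o\<close>, which is the shift
  by 1. Energies are integers, so the strict inequality between \<Gamma> and the depth of the other
  wells is a gap of at least 1, and this gap separates the time scales. The general theorem asks
  that no state except the target lies below the start. For the start \<open>o\<close> and odd
  \<open>K * L\<close> this says that \<open>e\<close> is the only independent set larger than
  \<open>o\<close>; a Hamiltonian path of the grid shows it. The obstacle is the depth of an
  arbitrary configuration. Swaps preserve the particle number at the price of one temporary vacancy,
  and a configuration in which they cannot diminish one colour any further satisfies a purely local
  condition, which feeds the closest pair argument.\<close>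

fun killed :: "('s \<Rightarrow> 's \<Rightarrow> real) \<Rightarrow> 's set \<Rightarrow> 's set \<Rightarrow> nat \<Rightarrow> ('s \<Rightarrow> real) \<Rightarrow> 's \<Rightarrow> real" where
  "killed P X A 0 f x = f x"
| "killed P X A (Suc n) f x = (\<Sum>y\<in>X. P x y * (if y \<in> A then 0 else killed P X A n f y))"

lemma killed_cmult: "killed P X A n (\<lambda>y. c * f y) x = c * killed P X A n f x"
proof (induction n arbitrary: x)
  case (Suc n)
  show ?case
    unfolding killed.simps Suc.IH sum_distrib_left by (rule sum.cong) auto
qed simp

lemma killed_diff:
  "killed P X A n (\<lambda>y. f y - g y) x = killed P X A n f x - killed P X A n g x"
proof (induction n arbitrary: x)
  case (Suc n)
  show ?case
    unfolding killed.simps Suc.IH sum_subtractf[symmetric]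
    by (rule sum.cong) (auto simp: algebra_simps)
qed simp

text \<open>The Markov property at time \<open>m\<close>. \<open>killed P X A m f x\<close> is the
  expectation of \<open>f\<close> at time \<open>m\<close> on the event that \<open>A\<close> is
  avoided at times 1, ..., m; the starting point is never tested, because \<tau> counts positive
  times only.\<close>

lemma surv_add: "surv P X A (m + n) x = killed P X A m (surv P X A n) x"
proof (induction m arbitrary: x)
  case (Suc m)
  then show ?case by (simp cong: sum.cong if_cong)
qed simp

lemma surv_eq_killed: "surv P X A n x = killed P X A n (\<lambda>_. 1) x"
  by (induction n arbitrary: x) (simp_all cong: sum.cong if_cong)

text \<open>First-step analysis: the sum over \<open>k < n\<close> is the expectation of \<tau>
  truncated at \<open>n\<close>. Truncated sums postpone all questions of convergence.\<close>

lemma sum_surv_Suc: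
  "(\<Sum>k<Suc n. surv P X A k x) =
     1 + (\<Sum>y\<in>X. P x y * (if y \<in> A then 0 else \<Sum>k<n. surv P X A k y))"
proof -
  have "(\<Sum>k<Suc n. surv P X A k x) = 1 + (\<Sum>k<n. surv P X A (Suc k) x)"
    by (subst sum.lessThan_Suc_shift) simp
  also have "(\<Sum>k<n. surv P X A (Suc k) x) =
      (\<Sum>y\<in>X. \<Sum>k<n. P x y * (if y \<in> A then 0 else surv P X A k y))"
    by (subst sum.swap) simp
  also have "\<dots> = (\<Sum>y\<in>X. P x y * (if y \<in> A then 0 else \<Sum>k<n. surv P X A k y))"
    by (rule sum.cong) (auto simp: sum_distrib_left)
  finally show ?thesis .
qed

locale finite_chain =
  fixes X :: "'s set" and P :: "'s \<Rightarrow> 's \<Rightarrow> real"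
  assumes finite_X: "finite X"
    and P_nonneg: "a \<in> X \<Longrightarrow> b \<in> X \<Longrightarrow> 0 \<le> P a b"
    and P_sum: "a \<in> X \<Longrightarrow> (\<Sum>b\<in>X. P a b) = 1"
begin

lemma avg_le:
  assumes "a \<in> X" "\<And>b. b \<in> X \<Longrightarrow> f b \<le> c"
  shows "(\<Sum>b\<in>X. P a b * f b) \<le> c"
proof -
  have "(\<Sum>b\<in>X. P a b * f b) \<le> (\<Sum>b\<in>X. P a b * c)"
    using assms P_nonneg by (intro sum_mono mult_left_mono) auto
  also have "\<dots> = c"
    using P_sum[OF assms(1)] by (simp add: sum_distrib_right[symmetric])
  finally show ?thesis .
qed

lemma avg_mono:
  assumes "a \<in> X" "\<And>b. b \<in> X \<Longrightarrow> f b \<le> g b"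
  shows "(\<Sum>b\<in>X. P a b * f b) \<le> (\<Sum>b\<in>X. P a b * g b)"
  using assms P_nonneg by (intro sum_mono mult_left_mono) auto

lemma killed_mono:
  assumes "\<And>y. y \<in> X - A \<Longrightarrow> f y \<le> g y" "x \<in> X - A"
  shows "killed P X A n f x \<le> killed P X A n g x"
  using assms(2)
proof (induction n arbitrary: x)
  case 0
  then show ?case using assms by simp
next
  case (Suc n)
  then show ?case unfolding killed.simps by (intro avg_mono) auto
qed

lemma surv_nonneg: "x \<in> X \<Longrightarrow> 0 \<le> surv P X A n x"
  by (induction n arbitrary: x) (auto intro!: sum_nonneg mult_nonneg_nonneg P_nonneg)

lemma surv_le_1: "x \<in> X \<Longrightarrow> surv P X A n x \<le> 1"
proof (induction n arbitrary: x)
  case (Suc n)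
  then show ?case unfolding surv.simps by (intro avg_le) auto
qed simp

lemma surv_Suc_le: "x \<in> X \<Longrightarrow> surv P X A (Suc n) x \<le> surv P X A n x"
proof (induction n arbitrary: x)
  case 0
  then show ?case using surv_le_1[of x A 1] by simp
next
  case (Suc n)
  show ?case
    unfolding surv.simps(2)[of P X A "Suc n"] surv.simps(2)[of P X A n]
    using Suc by (intro avg_mono) auto
qed

lemma surv_antimono: "x \<in> X \<Longrightarrow> m \<le> n \<Longrightarrow> surv P X A n x \<le> surv P X A m x"
  using lift_Suc_antimono_le[of "\<lambda>n. surv P X A n x" m n] surv_Suc_le by blast

lemma surv_antimono_set: "x \<in> X \<Longrightarrow> A \<subseteq> B \<Longrightarrow> surv P X B n x \<le> surv P X A n x"
proof (induction n arbitrary: x)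
  case (Suc n)
  then show ?case
    unfolding surv.simps(2) by (intro avg_mono) (auto simp: surv_nonneg)
qed simp

lemma surv_le_sum:
  assumes "x \<in> X"
  shows "real n * surv P X A n x \<le> (\<Sum>k<n. surv P X A k x)"
proof -
  have "real n * surv P X A n x = (\<Sum>k<n. surv P X A n x)" by simp
  also have "\<dots> \<le> (\<Sum>k<n. surv P X A k x)"
    using assms by (intro sum_mono surv_antimono) auto
  finally show ?thesis .
qed

text \<open>The tail of the series from \<open>t\<close> on is the expected remaining time, computed
  by restarting the chain at time \<open>t\<close>.\<close>

lemma sums_surv_add:
  assumes "\<And>v. v \<in> X \<Longrightarrow> (\<lambda>k. surv P X A k v) sums h v" "z \<in> X"
  shows "(\<lambda>k. surv P X A (t + k) z) sums killed P X A t h z"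
  using assms(2)
proof (induction t arbitrary: z)
  case 0
  then show ?case using assms(1) by simp
next
  case (Suc t)
  have "(\<lambda>k. \<Sum>y\<in>X. P z y * (if y \<in> A then 0 else surv P X A (t + k) y))
      sums (\<Sum>y\<in>X. P z y * (if y \<in> A then 0 else killed P X A t h y))"
    using Suc.IH by (intro sums_sum sums_mult) auto
  then show ?case by simp
qed

text \<open>Run the chain until it meets \<open>x\<close> or \<open>y\<close>; if it meets
  \<open>x\<close> first, at most \<open>T\<close> is still to come.\<close>

lemma sum_surv_upper:
  assumes xX: "x \<in> X" and T: "\<And>n. (\<Sum>k<n. surv P X {y} k x) \<le> T" and z: "z \<in> X"
  shows "(\<Sum>k<n. surv P X {y} k z) \<le> T + (\<Sum>k<n. surv P X {x, y} k z)"
  using z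
proof (induction n arbitrary: z)
  case 0
  then show ?case using T[of 0] by simp
next
  case (Suc n)
  have "0 \<le> T" using T[of 0] by simp
  have "(\<Sum>v\<in>X. P z v * (if v \<in> {y} then 0 else \<Sum>k<n. surv P X {y} k v))
      \<le> (\<Sum>v\<in>X. P z v * (T + (if v \<in> {x, y} then 0 else \<Sum>k<n. surv P X {x, y} k v)))"
    using Suc T \<open>0 \<le> T\<close> by (intro avg_mono) auto
  also have "\<dots> = T + (\<Sum>v\<in>X. P z v * (if v \<in> {x, y} then 0 else \<Sum>k<n. surv P X {x, y} k v))"
    using P_sum[OF Suc.prems]
    by (simp only: distrib_left sum.distrib sum_distrib_right[symmetric] mult_1)
  finally show ?case unfolding sum_surv_Suc by simp
qed

text \<open>The difference is the probability that \<open>x\<close> but not \<open>y\<close> is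
  visited up to time \<open>r\<close>. In that event \<open>x\<close> comes before \<open>y\<close>,
  and a chain that has reached \<open>x\<close> first still needs \<open>h x\<close> on
  average.\<close>

lemma sums_surv_lower:
  assumes x: "x \<in> X" and h: "\<And>v. v \<in> X \<Longrightarrow> (\<lambda>k. surv P X {y} k v) sums h v" and z: "z \<in> X"
  shows "h x * (surv P X {y} r z - surv P X {x, y} r z) \<le> h z"
  using z
proof (induction r arbitrary: z)
  case 0
  have "0 \<le> h z" using h[OF 0] sums_le[OF _ sums_zero h[OF 0]] surv_nonneg[OF 0] by auto
  then show ?case by simp
next
  case (Suc r)
  have h0: "0 \<le> h v" if "v \<in> X" for v
    using sums_le[OF _ sums_zero h[OF that]] surv_nonneg[OF that] by auto
  have eq: "h z = 1 + (\<Sum>v\<in>X. P z v * (if v \<in> {y} then 0 else h v))"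
  proof -
    have "(\<lambda>k. surv P X {y} (1 + k) z) sums killed P X {y} 1 h z"
      using sums_surv_add[OF h Suc.prems, of 1] by simp
    then have "(\<lambda>k. surv P X {y} k z) sums (1 + killed P X {y} 1 h z)"
      using sums_Suc[of "\<lambda>k. surv P X {y} k z" "killed P X {y} 1 h z"] by (simp add: add.commute)
    then have "h z = 1 + killed P X {y} 1 h z"
      using sums_unique2 h[OF Suc.prems] by blast
    then show ?thesis by (simp cong: if_cong)
  qed
  have "h x * (surv P X {y} (Suc r) z - surv P X {x, y} (Suc r) z) =
      (\<Sum>v\<in>X. P z v * (h x * ((if v \<in> {y} then 0 else surv P X {y} r v) -
         (if v \<in> {x, y} then 0 else surv P X {x, y} r v))))"
    unfolding surv.simps sum_subtractf[symmetric] sum_distrib_left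
    by (rule sum.cong) (auto simp: algebra_simps)
  also have "\<dots> \<le> (\<Sum>v\<in>X. P z v * (if v \<in> {y} then 0 else h v))"
  proof (rule avg_mono[OF Suc.prems])
    fix v assume v: "v \<in> X"
    have "h x * surv P X {y} r x \<le> h x"
      using surv_le_1[OF x, of "{y}" r] h0[OF x] by (simp add: mult_left_le)
    then show "h x * ((if v \<in> {y} then 0 else surv P X {y} r v) -
         (if v \<in> {x, y} then 0 else surv P X {x, y} r v)) \<le> (if v \<in> {y} then 0 else h v)"
      using Suc.IH[OF v] by auto
  qed
  also have "\<dots> \<le> h z" unfolding eq by simp
  finally show ?case .
qed

text \<open>
  With \<open>u t\<close> the probability of surviving up to time \<open>t\<close>, the remaining expectation
  \<open>m t = T - (\<Sum>k<t. u k)\<close> is close to \<open>T * u t\<close>, because from anywhere the chain soon returns to \<open>x\<close>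
  or hits \<open>y\<close>. Thus \<open>m\<close> nearly satisfies the recurrence \<open>m (t + 1) = (1 - 1 / T) * m t\<close>.
\<close>
lemma surv_close_to_geometric:
  assumes x: "x \<in> X" and "x \<noteq> y"
    and sums: "\<And>v. v \<in> X \<Longrightarrow> summable (\<lambda>k. surv P X {y} k v)"
    and C: "\<And>z n. z \<in> X \<Longrightarrow> (\<Sum>k<n. surv P X {x, y} k z) \<le> C"
    and T: "T = (\<Sum>k. surv P X {y} k x)" and R: "0 < (R::nat)"
  shows "\<bar>surv P X {y} t x - (1 - 1 / T) ^ t\<bar> \<le> 2 * (R / T + C / R + C / T)"
proof -
  define u where "u t = surv P X {y} t x" for t
  define h where "h v = (\<Sum>k. surv P X {y} k v)" for v
  define m where "m t = T - (\<Sum>k<t. u k)" for t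
  define \<eta> where "\<eta> = R / T + C / R + C / T"
  have h: "(\<lambda>k. surv P X {y} k v) sums h v" if "v \<in> X" for v
    using sums[OF that] unfolding h_def by (rule summable_sums)
  have hx: "h x = T" by (simp add: h_def T)
  have u0: "0 \<le> u t" and u1: "u t \<le> 1" for t
    using surv_nonneg[OF x] surv_le_1[OF x] by (auto simp: u_def)
  have T_ge: "(\<Sum>k<n. u k) \<le> T" for n
    unfolding T u_def by (rule sum_le_suminf) (auto simp: sums x surv_nonneg)
  have T1: "1 \<le> T" using T_ge[of 1] by (simp add: u_def)
  have C0: "0 \<le> C" using C[OF x, of 0] by simp
  have m_sums: "(\<lambda>k. u (t + k)) sums m t" for t
  proof -
    have "u sums T" using h[OF x] by (simp add: hx u_def[abs_def])
    then show ?thesis unfolding m_def by (subst add.commute) (rule sums_iff_shift[THEN iffD2], simp)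
  qed
  have m_killed: "m t = killed P X {y} t h x" for t
    using sums_surv_add[OF h x, of t] m_sums[of t] sums_unique2 unfolding u_def by blast
  have xy: "x \<in> X - {y}" using x \<open>x \<noteq> y\<close> by simp
  have h_up: "h z \<le> T + C" if z: "z \<in> X" for z
  proof (rule suminf_le_const[OF sums[OF z], folded h_def])
    fix n
    show "(\<Sum>k<n. surv P X {y} k z) \<le> T + C"
      using sum_surv_upper[OF x _ z, of y T n] T_ge C[OF z, of n] unfolding u_def by force
  qed
  have up: "m t \<le> T * u t + C" for t
  proof -
    have "m t \<le> killed P X {y} t (\<lambda>z. (T + C) * 1) x"
      unfolding m_killed using h_up by (intro killed_mono xy) auto
    also have "\<dots> = (T + C) * u t" unfolding killed_cmult u_def surv_eq_killed ..
    also have "\<dots> \<le> T * u t + C" using u1[of t] C0 by (simp add: algebra_simps mult_left_le)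
    finally show ?thesis .
  qed
  \<comment> \<open>Markov's inequality for the time to reach \<open>x\<close> or \<open>y\<close>,
    whose mean is bounded by \<open>C\<close>.\<close>
  have w_le: "surv P X {x, y} R z \<le> C / R" if z: "z \<in> X" for z
    using surv_le_sum[OF z, of R "{x, y}"] C[OF z, of R] R by (simp add: field_simps)
  \<comment> \<open>Only visits to \<open>x\<close> within \<open>R\<close> further steps are seen
    here, hence the bound is on the delayed value \<open>u (t + R)\<close>.\<close>
  have low: "T * (u (t + R) - C / R) \<le> m t" for t
  proof -
    have "killed P X {y} t (\<lambda>z. T * (surv P X {y} R z - C / R * 1)) x \<le> m t"
      unfolding m_killed
    proof (intro killed_mono xy)
      fix z assume z: "z \<in> X - {y}"
      have "T * (surv P X {y} R z - C / R * 1) \<le> T * (surv P X {y} R z - surv P X {x, y} R z)"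
        using w_le[of z] z T1 by (intro mult_left_mono) auto
      also have "\<dots> \<le> h z"
        using sums_surv_lower[OF x h, of z R] z by (simp add: hx)
      finally show "T * (surv P X {y} R z - C / R * 1) \<le> h z" .
    qed
    also have "killed P X {y} t (\<lambda>z. T * (surv P X {y} R z - C / R * 1)) x =
        T * (u (t + R) - C / R * u t)"
      unfolding killed_cmult killed_diff u_def surv_add surv_eq_killed[of _ _ _ t] by simp
    finally have "T * (u (t + R) - C / R * u t) \<le> m t" .
    moreover have "T * (u (t + R) - C / R) \<le> T * (u (t + R) - C / R * u t)"
      using T1 mult_left_le[OF u1[of t], of "C / R"] C0 by (intro mult_left_mono) auto
    ultimately show ?thesis by linarith
  qed
  \<comment> \<open>The delay is undone by \<open>m s \<le> m (s + R) + R\<close>, which costs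
    \<open>R / T\<close>. For \<open>t < R\<close> the same loss appears because \<open>m t\<close>
    is within \<open>R\<close> of \<open>T\<close>.\<close>
  have low': "u t \<le> m t / T + R / T + C / R" for t
  proof (cases "t < R")
    case True
    have "(\<Sum>k<t. u k) \<le> (\<Sum>k<t. 1)" by (intro sum_mono u1)
    then have "T \<le> m t + R" using True by (simp add: m_def)
    then have "1 \<le> m t / T + R / T" using T1 by (simp add: field_simps)
    then show ?thesis using u1[of t] C0 by (smt (verit) divide_nonneg_nonneg of_nat_0_le_iff)
  next
    case False
    then obtain s where s: "t = s + R" by (metis add.commute le_iff_add not_less)
    have "(\<Sum>k<t. u k) = (\<Sum>k<s. u k) + (\<Sum>k=s..<t. u k)"
      by (metis atLeast0LessThan le_add1 s sum.atLeastLessThan_concat zero_le)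
    moreover have "(\<Sum>k=s..<t. u k) \<le> (\<Sum>k=s..<t. 1)" by (intro sum_mono u1)
    ultimately have "m s \<le> m t + R" by (simp add: m_def s)
    then have "T * (u t - C / R) \<le> m t + R" using low[of s] s by simp
    then have "u t - C / R \<le> (m t + R) / T" using T1 by (simp add: field_simps)
    then show ?thesis by (simp add: add_divide_distrib)
  qed
  have up': "m t / T \<le> u t + C / T" for t
    using up[of t] T1 by (simp add: field_simps)
  have close: "\<bar>u t - m t / T\<bar> \<le> \<eta>" for t
  proof -
    have "0 \<le> R / T" "0 \<le> C / R" "0 \<le> C / T" using C0 T1 by auto
    then show ?thesis using low'[of t] up'[of t] unfolding \<eta>_def by linarith
  qed
  \<comment> \<open>Each step contracts the error by \<open>1 - 1 / T\<close> and adds at most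
    \<open>\<eta>\<close>. The bound \<open>\<eta> * T\<close> is the fixed point of this map, so
    errors do not accumulate with \<open>t\<close>.\<close>
  have geo: "\<bar>m t - T * (1 - 1 / T) ^ t\<bar> \<le> \<eta> * T" for t
  proof (induction t)
    case 0
    show ?case using close[of 0] T1 by (auto simp: m_def)
  next
    case (Suc t)
    have "m (Suc t) - T * (1 - 1 / T) ^ Suc t =
        (1 - 1 / T) * (m t - T * (1 - 1 / T) ^ t) + (m t / T - u t)"
      using T1 by (simp add: m_def field_simps)
    also have "\<bar>\<dots>\<bar> \<le> (1 - 1 / T) * (\<eta> * T) + \<eta>"
    proof -
      have "\<bar>(1 - 1 / T) * (m t - T * (1 - 1 / T) ^ t)\<bar> \<le> (1 - 1 / T) * (\<eta> * T)"
        using Suc T1 by (simp add: abs_mult mult_left_mono)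
      then show ?thesis using close[of t] by linarith
    qed
    also have "\<dots> = \<eta> * T" using T1 by (simp add: field_simps)
    finally show ?case .
  qed
  have "\<bar>m t / T - (1 - 1 / T) ^ t\<bar> \<le> \<eta>"
  proof -
    have "m t / T - (1 - 1 / T) ^ t = (m t - T * (1 - 1 / T) ^ t) / T"
      using T1 by (simp add: field_simps)
    also have "\<bar>\<dots>\<bar> \<le> \<eta> * T / T"
      using geo[of t] T1 by (simp add: abs_divide pos_divide_le_eq)
    finally show ?thesis using T1 by simp
  qed
  then have "\<bar>u t - (1 - 1 / T) ^ t\<bar> \<le> 2 * \<eta>"
    using close[of t] by (simp add: abs_le_iff)
  then show ?thesis unfolding u_def \<eta>_def .
qed

end

section \<open>Reversible Metropolis chains\<close>

text \<open>Heights are tested on the two ends of a step, so the empty path exists at every level;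
  only paths between distinct states bound the heights of their ends.\<close>

definition level_step :: "'s set \<Rightarrow> ('s \<Rightarrow> 's \<Rightarrow> bool) \<Rightarrow> ('s \<Rightarrow> real) \<Rightarrow> real \<Rightarrow> 's \<Rightarrow> 's \<Rightarrow> bool" where
  "level_step X E H h a b \<longleftrightarrow> a \<in> X \<and> b \<in> X \<and> a \<noteq> b \<and> E a b \<and> H a \<le> h \<and> H b \<le> h"

abbreviation level_path :: "'s set \<Rightarrow> ('s \<Rightarrow> 's \<Rightarrow> bool) \<Rightarrow> ('s \<Rightarrow> real) \<Rightarrow> real \<Rightarrow> 's \<Rightarrow> 's \<Rightarrow> bool" where
  "level_path X E H h \<equiv> (level_step X E H h)\<^sup>*\<^sup>*"

lemma level_path_mono: "h \<le> h' \<Longrightarrow> level_path X E H h a b \<Longrightarrow> level_path X E H h' a b"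
  by (erule rtranclp_mono[THEN predicate2D, rotated]) (auto simp: level_step_def)

text \<open>A shortest path has at most as many steps as the relation has pairs. A crude bound
  suffices, as long as it does not depend on \<beta>.\<close>

lemma level_path_bounded_length:
  assumes "finite X" "level_path X E H h a b"
  obtains n where "n \<le> (card X)\<^sup>2" "(level_step X E H h ^^ n) a b"
proof -
  define R where "R = {(a, b). level_step X E H h a b}"
  have sub: "R \<subseteq> X \<times> X" by (auto simp: R_def level_step_def)
  then have "finite R" using assms(1) finite_subset by blast
  have "card R \<le> (card X)\<^sup>2"
    using card_mono[OF _ sub] assms(1) by (simp add: card_cartesian_product power2_eq_square)
  moreover have "(a, b) \<in> R\<^sup>*" using assms(2) by (simp add: R_def rtranclp_rtrancl_eq)
  then obtain n where "n \<le> card R" "(a, b) \<in> R ^^ n"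
    using rtrancl_finite_eq_relpow[OF \<open>finite R\<close>] by auto
  moreover have "(\<lambda>a b. (a, b) \<in> R) = level_step X E H h" by (simp add: R_def)
  then have "(level_step X E H h ^^ n) a b"
    using \<open>(a, b) \<in> R ^^ n\<close> relpowp_relpow_eq[of n R] by simp
  ultimately show thesis using that order_trans by blast
qed

lemma path_difference_bound:
  fixes f :: "'s \<Rightarrow> real"
  assumes "\<And>a b. level_step X E H h a b \<Longrightarrow> \<bar>f a - f b\<bar> \<le> D"
  shows "(level_step X E H h ^^ n) a b \<Longrightarrow> \<bar>f a - f b\<bar> \<le> n * D"
proof (induction n arbitrary: b)
  case (Suc n)
  then obtain c where "(level_step X E H h ^^ n) a c" "level_step X E H h c b" by auto
  then have "\<bar>f a - f c\<bar> \<le> n * D" "\<bar>f c - f b\<bar> \<le> D" using Suc assms by auto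
  then show ?case by (simp add: algebra_simps)
qed simp

text \<open>The expected number of visits to \<open>z\<close> at times 0, ..., n - 1 before
  \<open>A\<close>. Unlike \<open>surv\<close> it also tests the starting point, so that it vanishes
  on \<open>A\<close>, as the estimate along a path into \<open>A\<close> requires.\<close>

fun green :: "('s \<Rightarrow> 's \<Rightarrow> real) \<Rightarrow> 's set \<Rightarrow> 's set \<Rightarrow> 's \<Rightarrow> nat \<Rightarrow> 's \<Rightarrow> real" where
  "green P X A z 0 w = 0"
| "green P X A z (Suc n) w =
     (if w \<in> A then 0 else (if w = z then 1 else 0) + (\<Sum>v\<in>X. P w v * green P X A z n v))"

context finite_chain
begin

lemma green_nonneg: "w \<in> X \<Longrightarrow> 0 \<le> green P X A z n w"
  by (induction n arbitrary: w) (auto intro!: add_nonneg_nonneg sum_nonneg mult_nonneg_nonneg P_nonneg)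

lemma green_killed: "w \<in> A \<Longrightarrow> green P X A z n w = 0"
  by (cases n) auto

lemma green_Suc_ge: "w \<in> X \<Longrightarrow> green P X A z n w \<le> green P X A z (Suc n) w"
proof (induction n arbitrary: w)
  case 0
  then show ?case using green_nonneg[of w A z 1] by simp
next
  case (Suc n)
  show ?case
    unfolding green.simps(2)[of P X A z "Suc n"] green.simps(2)[of P X A z n w]
    using Suc by (auto intro!: avg_mono simp del: green.simps)
qed

text \<open>Maximum principle: visits to \<open>z\<close> are counted only after \<open>z\<close>
  has been reached, and fewer steps are left then.\<close>

lemma green_le_diagonal:
  assumes z: "z \<in> X" and "w \<in> X"
  shows "green P X A z n w \<le> green P X A z n z"
  using assms(2)
proof (induction n arbitrary: w)
  case (Suc n)
  consider "w \<in> A" | "w = z" | "w \<notin> A" "w \<noteq> z" by blast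
  then show ?case
  proof cases
    case 1
    then show ?thesis using green_killed green_nonneg[OF z, of A z "Suc n"] by metis
  next
    case 3
    then have "green P X A z (Suc n) w = (\<Sum>v\<in>X. P w v * green P X A z n v)" by simp
    also have "\<dots> \<le> green P X A z n z" using Suc by (intro avg_le) auto
    finally show ?thesis using green_Suc_ge[OF z, of A z n] by linarith
  qed simp
qed simp

text \<open>Every time unit before \<open>A\<close> is spent at exactly one state.\<close>

lemma sum_surv_eq_green:
  assumes A: "A \<subseteq> X" and w: "w \<in> X - A"
  shows "(\<Sum>k<n. surv P X A k w) = (\<Sum>z\<in>X - A. green P X A z n w)"
  using w
proof (induction n arbitrary: w)
  case (Suc n)
  have "(\<Sum>z\<in>X - A. green P X A z (Suc n) w) =
      (\<Sum>z\<in>X - A. (if w = z then 1 else 0)) + (\<Sum>z\<in>X - A. \<Sum>v\<in>X. P w v * green P X A z n v)"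
    using Suc.prems by (simp add: sum.distrib)
  also have "(\<Sum>z\<in>X - A. (if w = z then 1 else 0)) = (1::real)"
    using Suc.prems finite_X by simp
  also have "(\<Sum>z\<in>X - A. \<Sum>v\<in>X. P w v * green P X A z n v) =
      (\<Sum>v\<in>X. P w v * (if v \<in> A then 0 else \<Sum>k<n. surv P X A k v))"
    by (subst sum.swap) (auto intro!: sum.cong simp: sum_distrib_left[symmetric] Suc.IH green_killed)
  finally show ?case unfolding sum_surv_Suc by simp
qed simp

end

locale metropolis =
  fixes X :: "'s set" and E :: "'s \<Rightarrow> 's \<Rightarrow> bool" and H :: "'s \<Rightarrow> real"
    and N \<beta> :: real and P :: "'s \<Rightarrow> 's \<Rightarrow> real"
  assumes finite_states: "finite X" and N_pos: "0 < N" and beta_nonneg: "0 \<le> \<beta>"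
    and E_sym: "a \<in> X \<Longrightarrow> b \<in> X \<Longrightarrow> E a b \<Longrightarrow> E b a"
    and E_degree: "a \<in> X \<Longrightarrow> real (card {b \<in> X - {a}. E a b}) \<le> N"
    and P_off: "a \<in> X \<Longrightarrow> b \<in> X \<Longrightarrow> a \<noteq> b \<Longrightarrow>
      P a b = (if E a b then exp (- \<beta> * max 0 (H b - H a)) / N else 0)"
    and P_diag: "a \<in> X \<Longrightarrow> P a a = 1 - (\<Sum>b\<in>X - {a}. P a b)"
begin

lemma P_row: "a \<in> X \<Longrightarrow> (\<Sum>b\<in>X. P a b) = 1"
  using finite_states P_diag[of a] by (subst sum.remove[of _ a]) auto

lemma P_ge_0: "a \<in> X \<Longrightarrow> b \<in> X \<Longrightarrow> 0 \<le> P a b"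
proof (cases "a = b")
  case True
  assume a: "a \<in> X"
  have "(\<Sum>b\<in>X - {a}. P a b) \<le> (\<Sum>b\<in>X - {a}. if E a b then 1 / N else 0)"
    using N_pos beta_nonneg a
    by (intro sum_mono) (auto simp: P_off divide_right_mono)
  also have "\<dots> = card {b \<in> X - {a}. E a b} / N"
    using finite_states by (simp add: sum.If_cases Int_def)
  also have "\<dots> \<le> 1" using E_degree[OF a] N_pos by simp
  finally show ?thesis using P_diag[OF a] True by simp
qed (use N_pos P_off in auto)

sublocale finite_chain X P
  by unfold_locales (use finite_states P_ge_0 P_row in auto)

definition weight :: "'s \<Rightarrow> real" where
  "weight a = exp (- \<beta> * H a)"

lemma weight_pos: "0 < weight a"
  by (simp add: weight_def)

text \<open>Only the higher of the two energies enters. This symmetry is reversibility, and it is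
  why path levels govern the chain.\<close>

lemma conductance:
  assumes "a \<in> X" "b \<in> X" "a \<noteq> b"
  shows "weight a * P a b = (if E a b then exp (- \<beta> * max (H a) (H b)) / N else 0)"
proof -
  have "- \<beta> * H a + - \<beta> * max 0 (H b - H a) = - \<beta> * max (H a) (H b)"
    by (simp add: max_def algebra_simps)
  then show ?thesis using assms by (simp add: P_off weight_def exp_add[symmetric])
qed

lemma detailed_balance:
  assumes "a \<in> X" "b \<in> X"
  shows "weight a * P a b = weight b * P b a"
  using assms E_sym by (cases "a = b") (auto simp: conductance max.commute)

text \<open>The Dirichlet form, written as the weighted inner product of \<open>f\<close> with
  \<open>f - P f\<close>. In this shape it can be evaluated for Green functions;
  \<open>energy_eq\<close> turns it into a sum of squares, from which single edges can be read
  off.\<close>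

definition energy :: "('s \<Rightarrow> real) \<Rightarrow> real" where
  "energy f = (\<Sum>a\<in>X. weight a * f a * (f a - (\<Sum>b\<in>X. P a b * f b)))"

lemma energy_eq: "2 * energy f = (\<Sum>a\<in>X. \<Sum>b\<in>X. weight a * P a b * (f a - f b)\<^sup>2)"
proof -
  define S where "S = (\<Sum>a\<in>X. weight a * (f a)\<^sup>2)"
  define M where "M = (\<Sum>a\<in>X. \<Sum>b\<in>X. weight a * P a b * (f a * f b))"
  have 1: "(\<Sum>a\<in>X. \<Sum>b\<in>X. weight a * P a b * (f a)\<^sup>2) = S"
    unfolding S_def
  proof (rule sum.cong)
    fix a assume "a \<in> X"
    have "(\<Sum>b\<in>X. weight a * P a b * (f a)\<^sup>2) = weight a * (f a)\<^sup>2 * (\<Sum>b\<in>X. P a b)"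
      unfolding sum_distrib_left by (rule sum.cong) (auto simp: mult_ac)
    then show "(\<Sum>b\<in>X. weight a * P a b * (f a)\<^sup>2) = weight a * (f a)\<^sup>2"
      using P_row[OF \<open>a \<in> X\<close>] by simp
  qed simp
  have "(\<Sum>a\<in>X. \<Sum>b\<in>X. weight a * P a b * (f b)\<^sup>2) =
      (\<Sum>b\<in>X. \<Sum>a\<in>X. weight b * P b a * (f b)\<^sup>2)"
    using detailed_balance by (subst sum.swap) (auto intro!: sum.cong)
  then have 2: "(\<Sum>a\<in>X. \<Sum>b\<in>X. weight a * P a b * (f b)\<^sup>2) = S"
    using 1 by simp
  have "energy f = S - M"
    unfolding energy_def S_def M_def sum_subtractf[symmetric]
    by (rule sum.cong)
      (auto simp: right_diff_distrib sum_distrib_left power2_eq_square mult.assoc mult.left_commute)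
  moreover have "(\<Sum>a\<in>X. \<Sum>b\<in>X. weight a * P a b * (f a - f b)\<^sup>2) =
      (\<Sum>a\<in>X. \<Sum>b\<in>X. weight a * P a b * (f a)\<^sup>2 + weight a * P a b * (f b)\<^sup>2
        - 2 * (weight a * P a b * (f a * f b)))"
    by (intro sum.cong refl) (simp add: power2_diff algebra_simps)
  then have "(\<Sum>a\<in>X. \<Sum>b\<in>X. weight a * P a b * (f a - f b)\<^sup>2) = S + S - 2 * M"
    unfolding sum.distrib sum_subtractf sum_distrib_left[symmetric] 1 2 M_def .
  ultimately show ?thesis by simp
qed

text \<open>Each edge occurs in both orientations in the sum of squares, which absorbs the factor 2
  of \<open>energy_eq\<close>.\<close>

lemma energy_ge_edge:
  assumes "u \<in> X" "v \<in> X" "u \<noteq> v"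
  shows "weight u * P u v * (f u - f v)\<^sup>2 \<le> energy f"
proof -
  let ?g = "\<lambda>a b. weight a * P a b * (f a - f b)\<^sup>2"
  have g0: "0 \<le> ?g a b" if "a \<in> X" "b \<in> X" for a b
    using that P_ge_0 weight_pos[of a] by simp
  have sym: "?g v u = ?g u v"
    using detailed_balance[OF assms(1,2)] by (simp add: power2_commute)
  have row: "?g a b \<le> (\<Sum>b\<in>X. ?g a b)" if "a \<in> X" "b \<in> X" for a b
    using that finite_states g0 by (intro member_le_sum) auto
  have "(\<Sum>a\<in>{u, v}. \<Sum>b\<in>X. ?g a b) \<le> (\<Sum>a\<in>X. \<Sum>b\<in>X. ?g a b)"
    using assms finite_states g0 by (intro sum_mono2) (auto intro!: sum_nonneg)
  then have "(\<Sum>b\<in>X. ?g u b) + (\<Sum>b\<in>X. ?g v b) \<le> 2 * energy f"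
    using assms(3) by (simp add: energy_eq)
  then show ?thesis using row[OF assms(1,2)] row[OF assms(2,1)] sym by linarith
qed

text \<open>
  Truncating the Green function after \<open>n\<close> steps is harmless: it is nondecreasing in \<open>n\<close>, so it is
  still a subsolution of the Poisson equation with unit source at \<open>z\<close>.
\<close>
lemma energy_green:
  assumes z: "z \<in> X"
  shows "energy (green P X A z n) \<le> weight z * green P X A z n z"
proof -
  let ?G = "green P X A z n"
  have "energy ?G \<le> (\<Sum>w\<in>X. if w = z then weight z * ?G z else 0)"
    unfolding energy_def
  proof (rule sum_mono)
    fix w assume w: "w \<in> X"
    have Gw: "0 \<le> ?G w" by (rule green_nonneg[OF w])
    show "weight w * ?G w * (?G w - (\<Sum>b\<in>X. P w b * ?G b)) \<le>
        (if w = z then weight z * ?G z else 0)"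
    proof (cases "w \<in> A")
      case True
      then show ?thesis using green_killed[OF True] weight_pos[of z] by auto
    next
      case False
      then have "?G w - (\<Sum>b\<in>X. P w b * ?G b) \<le> (if w = z then 1 else 0)"
        using green_Suc_ge[OF w, of A z n] by simp
      then have "weight w * ?G w * (?G w - (\<Sum>b\<in>X. P w b * ?G b)) \<le>
          weight w * ?G w * (if w = z then 1 else 0)"
        using Gw weight_pos[of w] by (intro mult_left_mono) auto
      then show ?thesis by (simp split: if_splits)
    qed
  qed
  also have "\<dots> = weight z * ?G z" using z finite_states by simp
  finally show ?thesis .
qed

text \<open>Along the path the Green function falls from its value at \<open>z\<close> to 0, and
  \<open>B\<close>, a multiple of that same value, bounds the square of each increment. So the
  square of the value is at most a constant times the value, and one factor cancels. The fourth
  power is the squared bound on the path length.\<close>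

lemma green_bound:
  assumes z: "z \<in> X" and w: "w \<in> X" and a: "a \<in> A" and path: "level_path X E H h z a"
  shows "green P X A z n w \<le> real (card X) ^ 4 * N * exp (\<beta> * (h - H z))"
proof -
  let ?G = "green P X A z n"
  define B where "B = N * exp (\<beta> * (h - H z)) * ?G z"
  have Gz: "0 \<le> ?G z" by (rule green_nonneg[OF z])
  have edge: "\<bar>?G u - ?G v\<bar> \<le> sqrt B" if uv: "level_step X E H h u v" for u v
  proof -
    have c: "exp (- \<beta> * h) / N \<le> weight u * P u v"
      using uv N_pos beta_nonneg
      by (auto simp: level_step_def conductance intro!: divide_right_mono mult_left_mono)
    have "exp (- \<beta> * h) / N * (?G u - ?G v)\<^sup>2 \<le> weight u * P u v * (?G u - ?G v)\<^sup>2"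
      using c by (rule mult_right_mono) simp
    also have "\<dots> \<le> weight z * ?G z"
      using energy_ge_edge[of u v ?G] energy_green[OF z, of A n] uv
      by (auto simp: level_step_def)
    finally have "N * exp (\<beta> * h) * (exp (- \<beta> * h) / N * (?G u - ?G v)\<^sup>2) \<le>
        N * exp (\<beta> * h) * (weight z * ?G z)"
      using N_pos by (intro mult_left_mono) auto
    moreover have "N * exp (\<beta> * h) * (exp (- \<beta> * h) / N * (?G u - ?G v)\<^sup>2) = (?G u - ?G v)\<^sup>2"
      using N_pos by (simp add: exp_minus field_simps)
    moreover have "N * exp (\<beta> * h) * (weight z * ?G z) = B"
      by (simp add: B_def weight_def exp_diff exp_minus right_diff_distrib field_simps)
    ultimately have "(?G u - ?G v)\<^sup>2 \<le> B" by simp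
    then show ?thesis using real_sqrt_le_mono by fastforce
  qed
  obtain k where k: "k \<le> (card X)\<^sup>2" "(level_step X E H h ^^ k) z a"
    using level_path_bounded_length[OF finite_states path] .
  have B0: "0 \<le> B" using Gz N_pos by (simp add: B_def)
  have "?G z \<le> k * sqrt B"
    using path_difference_bound[of X E H h ?G, OF edge k(2)] green_killed[OF a, of z n] Gz by simp
  also have "\<dots> \<le> (card X)\<^sup>2 * sqrt B"
    using k(1) B0 by (intro mult_right_mono) (auto simp: of_nat_le_iff simp flip: of_nat_power)
  finally have "(?G z)\<^sup>2 \<le> ((card X)\<^sup>2 * sqrt B)\<^sup>2"
    using Gz by (intro power_mono)
  also have "\<dots> = real (card X) ^ 4 * B"
    using B0 by (simp add: power_mult_distrib)
  finally have "?G z * ?G z \<le> (real (card X) ^ 4 * N * exp (\<beta> * (h - H z))) * ?G z"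
    by (simp add: B_def power2_eq_square mult.assoc)
  then have "?G z \<le> real (card X) ^ 4 * N * exp (\<beta> * (h - H z))"
    using Gz N_pos by (cases "?G z = 0") (auto simp: mult_le_cancel_right)
  then show ?thesis using green_le_diagonal[OF z w, of A n] by linarith
qed

text \<open>Summing the Green bound over \<open>z\<close> gives the fifth power. The leading 1
  covers a start inside \<open>A\<close>, where one step is made before \<open>A\<close> is
  tested.\<close>

lemma sum_surv_bound:
  assumes A: "A \<subseteq> X"
    and path: "\<And>z. z \<in> X - A \<Longrightarrow> \<exists>a\<in>A. level_path X E H (H z + D) z a"
    and w: "w \<in> X"
  shows "(\<Sum>k<n. surv P X A k w) \<le> 1 + real (card X) ^ 5 * N * exp (\<beta> * D)"
proof -
  define B where "B = real (card X) ^ 5 * N * exp (\<beta> * D)"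
  have B0: "0 \<le> B" using N_pos by (simp add: B_def)
  have inner: "(\<Sum>k<n. surv P X A k w) \<le> B" if "w \<in> X - A" for n w
  proof -
    have "(\<Sum>k<n. surv P X A k w) = (\<Sum>z\<in>X - A. green P X A z n w)"
      by (rule sum_surv_eq_green[OF A that])
    also have "\<dots> \<le> (\<Sum>z\<in>X - A. real (card X) ^ 4 * N * exp (\<beta> * D))"
    proof (rule sum_mono)
      fix z assume z: "z \<in> X - A"
      then obtain a where "a \<in> A" "level_path X E H (H z + D) z a" using path by blast
      then show "green P X A z n w \<le> real (card X) ^ 4 * N * exp (\<beta> * D)"
        using green_bound[of z w a A "H z + D" n] z that by simp
    qed
    also have "\<dots> = real (card (X - A)) * (real (card X) ^ 4 * N * exp (\<beta> * D))" by simp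
    also have "\<dots> \<le> real (card X) * (real (card X) ^ 4 * N * exp (\<beta> * D))"
      using N_pos finite_states by (intro mult_right_mono) (auto intro: card_mono)
    also have "\<dots> = B" by (simp add: B_def power_numeral_reduce mult.assoc)
    finally show ?thesis .
  qed
  have "(\<Sum>k<n. surv P X A k w) \<le> (\<Sum>k<Suc n. surv P X A k w)"
    using surv_nonneg[OF w] by simp
  also have "\<dots> \<le> 1 + B"
    unfolding sum_surv_Suc using w B0 inner by (intro add_left_mono avg_le) auto
  finally show ?thesis by (simp add: B_def)
qed

text \<open>Start from \<open>weight\<close> restricted to \<open>C\<close>. By reversibility
  \<open>s n\<close> is the density of the surviving mass, so it stays below 1 and each step loses
  at most the boundary flow \<open>F\<close>. The loss charged to \<open>x\<close> is part of the
  total loss.\<close>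

lemma exit_bound:
  assumes C: "C \<subseteq> X" and x: "x \<in> C"
    and exit: "\<And>a b. a \<in> C \<Longrightarrow> b \<in> X - C \<Longrightarrow> E a b \<Longrightarrow> h \<le> max (H a) (H b)"
  shows "1 - surv P X (X - C) n x \<le> n * ((real (card X))\<^sup>2 / N * exp (- \<beta> * (h - H x)))"
proof -
  define s where "s n z = surv P X (X - C) n z" for n z
  define F where "F = (\<Sum>a\<in>C. \<Sum>b\<in>X - C. weight a * P a b)"
  have finC: "finite C" using C finite_states finite_subset by blast
  have s1: "s n z \<le> 1" and s0: "0 \<le> s n z" if "z \<in> C" for n z
    using that C surv_le_1 surv_nonneg by (auto simp: s_def)
  have flux: "(\<Sum>z\<in>C. weight z) - n * F \<le> (\<Sum>z\<in>C. weight z * s n z)" for n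
  proof (induction n)
    case 0
    show ?case by (simp add: s_def)
  next
    case (Suc n)
    have "(\<Sum>z\<in>C. weight z * s (Suc n) z) = (\<Sum>z\<in>C. \<Sum>y\<in>C. weight z * P z y * s n y)"
    proof (rule sum.cong)
      fix z
      have "s (Suc n) z = (\<Sum>y\<in>C. P z y * s n y)"
        unfolding s_def surv.simps using C finite_states
        by (intro sum.mono_neutral_cong_right) auto
      then show "weight z * s (Suc n) z = (\<Sum>y\<in>C. weight z * P z y * s n y)"
        by (simp add: sum_distrib_left mult.assoc)
    qed simp
    also have "\<dots> = (\<Sum>y\<in>C. \<Sum>z\<in>C. weight y * P y z * s n y)"
    proof (subst sum.swap, intro sum.cong refl)
      fix y z assume "y \<in> C" "z \<in> C"
      then show "weight z * P z y * s n y = weight y * P y z * s n y"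
        using detailed_balance[of z y] C by auto
    qed
    also have "\<dots> = (\<Sum>y\<in>C. weight y * s n y - (\<Sum>b\<in>X - C. weight y * P y b) * s n y)"
    proof (rule sum.cong)
      fix y assume y: "y \<in> C"
      have "(\<Sum>z\<in>X. P y z) = (\<Sum>z\<in>C. P y z) + (\<Sum>b\<in>X - C. P y b)"
        using C finite_states by (simp add: add.commute sum.subset_diff)
      then have row: "(\<Sum>z\<in>C. P y z) = 1 - (\<Sum>b\<in>X - C. P y b)"
        using P_row[of y] y C by auto
      show "(\<Sum>z\<in>C. weight y * P y z * s n y) =
          weight y * s n y - (\<Sum>b\<in>X - C. weight y * P y b) * s n y"
        unfolding sum_distrib_right[symmetric] sum_distrib_left[symmetric] row
        by (simp add: algebra_simps)
    qed simp
    also have "\<dots> \<ge> (\<Sum>y\<in>C. weight y * s n y - (\<Sum>b\<in>X - C. weight y * P y b))"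
    proof (rule sum_mono)
      fix y assume y: "y \<in> C"
      have "0 \<le> (\<Sum>b\<in>X - C. weight y * P y b)"
        using y C weight_pos[of y] P_ge_0 by (intro sum_nonneg) auto
      then show "weight y * s n y - (\<Sum>b\<in>X - C. weight y * P y b) \<le>
          weight y * s n y - (\<Sum>b\<in>X - C. weight y * P y b) * s n y"
        using mult_left_le[OF s1[OF y]] by simp
    qed
    finally show ?case using Suc by (simp add: sum_subtractf F_def algebra_simps)
  qed
  have "F \<le> (\<Sum>a\<in>C. \<Sum>b\<in>X - C. exp (- \<beta> * h) / N)"
    unfolding F_def
  proof (intro sum_mono)
    fix a b assume ab: "a \<in> C" "b \<in> X - C"
    then have "E a b \<Longrightarrow> \<beta> * h \<le> \<beta> * max (H a) (H b)"
      using exit beta_nonneg by (intro mult_left_mono) auto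
    moreover have "a \<in> X" "b \<in> X" "a \<noteq> b" using ab C by auto
    ultimately show "weight a * P a b \<le> exp (- \<beta> * h) / N"
      using N_pos by (simp add: conductance divide_right_mono)
  qed
  also have "\<dots> = real (card C) * real (card (X - C)) * (exp (- \<beta> * h) / N)" by simp
  also have "\<dots> \<le> real (card X) * real (card X) * (exp (- \<beta> * h) / N)"
    using N_pos finite_states C
    by (intro mult_right_mono mult_mono) (auto intro: card_mono simp: of_nat_le_iff)
  finally have F: "F \<le> (real (card X))\<^sup>2 * (exp (- \<beta> * h) / N)" by (simp add: power2_eq_square)
  have "weight x * (1 - s n x) \<le> (\<Sum>z\<in>C. weight z * (1 - s n z))"
    using x finC s1 weight_pos by (intro member_le_sum) (auto simp: less_imp_le)
  also have "\<dots> \<le> n * F"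
    using flux[of n] by (simp add: right_diff_distrib sum_subtractf)
  also have "\<dots> \<le> n * ((real (card X))\<^sup>2 * (exp (- \<beta> * h) / N))"
    using F by (intro mult_left_mono) auto
  finally have "exp (\<beta> * H x) * (weight x * (1 - s n x)) \<le>
      exp (\<beta> * H x) * (n * ((real (card X))\<^sup>2 * (exp (- \<beta> * h) / N)))"
    by (intro mult_left_mono) auto
  moreover have "exp (\<beta> * H x) * (weight x * (1 - s n x)) = 1 - s n x"
    by (simp add: weight_def exp_minus)
  moreover have "exp (\<beta> * H x) * (n * ((real (card X))\<^sup>2 * (exp (- \<beta> * h) / N))) =
      n * ((real (card X))\<^sup>2 / N * exp (- \<beta> * (h - H x)))"
    by (simp add: exp_diff exp_minus right_diff_distrib field_simps)
  ultimately show ?thesis unfolding s_def[symmetric] by linarith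
qed

end

section \<open>Law and mean of the hitting time in terms of survival probabilities\<close>

lemma antimono_summable_imp_times_index_tendsto_0:
  fixes u :: "nat \<Rightarrow> real"
  assumes sum: "summable u" and dec: "\<And>m n. m \<le> n \<Longrightarrow> u n \<le> u m" and nonneg: "\<And>n. 0 \<le> u n"
  shows "(\<lambda>n. n * u n) \<longlonglongrightarrow> 0"
proof -
  let ?S = "\<lambda>n. \<Sum>k<n. u k"
  have lim: "?S \<longlonglongrightarrow> suminf u" by (rule summable_LIMSEQ[OF sum])
  have "filterlim (\<lambda>n::nat. n div 2) at_top at_top"
    by (rule filterlim_at_top[THEN iffD2], intro allI)
      (metis (no_types, lifting) div_le_mono eventually_at_top_linorder nonzero_mult_div_cancel_left
        zero_neq_numeral)
  then have "(\<lambda>n. ?S (n div 2)) \<longlonglongrightarrow> suminf u"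
    by (rule filterlim_compose[OF lim])
  then have "(\<lambda>n. 2 * (?S n - ?S (n div 2))) \<longlonglongrightarrow> 2 * (suminf u - suminf u)"
    by (intro tendsto_intros lim)
  then have up: "(\<lambda>n. 2 * (?S n - ?S (n div 2))) \<longlonglongrightarrow> 0" by simp
  show ?thesis
  proof (rule tendsto_sandwich[OF _ _ tendsto_const up])
    show "\<forall>\<^sub>F n in sequentially. 0 \<le> n * u n" using nonneg by simp
    show "\<forall>\<^sub>F n in sequentially. n * u n \<le> 2 * (?S n - ?S (n div 2))"
    proof (intro always_eventually allI)
      fix n :: nat
      \<comment> \<open>The upper half of the first \<open>n\<close> terms are all at least
        \<open>u n\<close>, and their sum is a difference of two partial sums with the same
        limit.\<close>
      have "real (n - n div 2) * u n = (\<Sum>k=n div 2..<n. u n)" by simp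
      also have "\<dots> \<le> (\<Sum>k=n div 2..<n. u k)" by (intro sum_mono dec) auto
      also have "\<dots> = ?S n - ?S (n div 2)"
        using sum_diff_nat_ivl[of 0 "n div 2" n u] by (simp add: lessThan_atLeast0)
      finally have "2 * real (n - n div 2) * u n \<le> 2 * (?S n - ?S (n div 2))"
        unfolding mult.assoc by (rule mult_left_mono) simp
      moreover have "real n * u n \<le> 2 * real (n - n div 2) * u n"
        using nonneg by (intro mult_right_mono) linarith+
      ultimately show "n * u n \<le> 2 * (?S n - ?S (n div 2))" by linarith
    qed
  qed
qed

context finite_chain
begin

lemma hit_pmf_Suc: "hit_pmf P X A x (Suc t) = surv P X A t x - surv P X A (Suc t) x"
  by (simp add: hit_pmf_def)

lemma sum_hit_pmf_interval:
  "p \<le> r \<Longrightarrow> (\<Sum>t\<in>{p<..r}. hit_pmf P X A x t) = surv P X A p x - surv P X A r x"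
proof (induction r rule: dec_induct)
  case (step r)
  have "{p<..Suc r} = insert (Suc r) {p<..r}" using step by auto
  then show ?case using step by (simp add: hit_pmf_Suc del: surv.simps)
qed simp

text \<open>Summation by parts; the boundary term \<open>n * surv P X A n x\<close> tends to
  0.\<close>

lemma sums_hit_mean:
  assumes x: "x \<in> X" and sum: "summable (\<lambda>k. surv P X A k x)"
  shows "(\<lambda>t. real t * hit_pmf P X A x t) sums (\<Sum>k. surv P X A k x)"
proof -
  let ?u = "\<lambda>k. surv P X A k x"
  have part: "(\<Sum>t<Suc n. real t * hit_pmf P X A x t) = (\<Sum>k<n. ?u k) - n * ?u n" for n
    by (induction n) (simp_all add: hit_pmf_Suc algebra_simps hit_pmf_def[of _ _ _ _ 0] del: surv.simps)
  have "(\<lambda>n. (\<Sum>k<n. ?u k) - n * ?u n) \<longlonglongrightarrow> (\<Sum>k. ?u k) - 0"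
    by (intro tendsto_diff summable_LIMSEQ[OF sum] antimono_summable_imp_times_index_tendsto_0)
      (use x in \<open>auto intro: surv_antimono surv_nonneg sum\<close>)
  then have "(\<lambda>n. \<Sum>t<Suc n. real t * hit_pmf P X A x t) \<longlonglongrightarrow> (\<Sum>k. ?u k)"
    unfolding part by simp
  then show ?thesis unfolding sums_def by (rule LIMSEQ_imp_Suc)
qed

lemma hit_scaled_cdf_eq:
  assumes "0 \<le> s" "0 < T" "T = hit_mean P X A x"
  shows "hit_scaled_cdf P X A x s = 1 - surv P X A (nat \<lfloor>s * T\<rfloor>) x"
proof -
  \<comment> \<open>Time 0 belongs to the set, but \<open>hit_pmf\<close> is 0 there.\<close>
  have "{t::nat. real t / T \<le> s} = insert 0 {0<..nat \<lfloor>s * T\<rfloor>}"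
    using assms by (auto simp: field_simps le_nat_floor)
      (metis mult.commute mult_nonneg_nonneg less_imp_le of_nat_floor of_nat_le_iff order_trans)+
  then show ?thesis
    using assms(3) sum_hit_pmf_interval[of 0 "nat \<lfloor>s * T\<rfloor>" A x]
    by (simp add: hit_scaled_cdf_def hit_pmf_def[of _ _ _ _ 0])
qed

lemma hit_scaled_cdf_neg:
  assumes "s < 0" "0 < hit_mean P X A x"
  shows "hit_scaled_cdf P X A x s = 0"
proof -
  have "0 \<le> real t / hit_mean P X A x" for t using assms by simp
  then have "{t::nat. real t / hit_mean P X A x \<le> s} = {}"
    using assms(1) by (auto simp: not_le intro: less_le_trans)
  then show ?thesis unfolding hit_scaled_cdf_def by (simp only: sum.empty)
qed

lemma hit_prob_between_eq:
  assumes "0 \<le> a" "a + 1 \<le> b"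
  shows "hit_prob_between P X A x a b =
    surv P X A (nat \<lfloor>a\<rfloor>) x - surv P X A (nat (\<lceil>b\<rceil> - 1)) x"
proof -
  \<comment> \<open>The inequalities are strict, so the last admissible time is \<lceil>b\<rceil> -
    1.\<close>
  have "{t::nat. a < real t \<and> real t < b} = {nat \<lfloor>a\<rfloor><..nat (\<lceil>b\<rceil> - 1)}"
    using assms by (auto simp: nat_less_iff floor_less_iff) linarith+
  moreover have "nat \<lfloor>a\<rfloor> \<le> nat (\<lceil>b\<rceil> - 1)" using assms by linarith
  ultimately show ?thesis by (simp add: hit_prob_between_def sum_hit_pmf_interval)
qed

end

lemma geometric_tendsto_exp:
  assumes "0 \<le> s"
  shows "((\<lambda>T::real. (1 - 1 / T) ^ nat \<lfloor>s * T\<rfloor>) \<longlongrightarrow> exp (- s)) at_top"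
proof (rule tendsto_sandwich)
  show "((\<lambda>T::real. (1 - 1 / T) powr (s * T)) \<longlongrightarrow> exp (- s)) at_top" by real_asymp
  show "((\<lambda>T::real. (1 - 1 / T) powr (s * T - 1)) \<longlongrightarrow> exp (- s)) at_top" by real_asymp
  have pow: "(1 - 1 / T) ^ nat \<lfloor>s * T\<rfloor> = (1 - 1 / T) powr \<lfloor>s * T\<rfloor>" if "1 < T" for T
    using that assms by (subst powr_realpow[symmetric]) auto
  show "\<forall>\<^sub>F T in at_top. (1 - 1 / T) powr (s * T) \<le> (1 - 1 / T) ^ nat \<lfloor>s * T\<rfloor>"
    using eventually_gt_at_top[of 1]
    by eventually_elim (auto simp: pow intro!: powr_mono')
  show "\<forall>\<^sub>F T in at_top. (1 - 1 / T) ^ nat \<lfloor>s * T\<rfloor> \<le> (1 - 1 / T) powr (s * T - 1)"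
    using eventually_gt_at_top[of 1]
    by eventually_elim (auto simp: pow intro!: powr_mono')
qed

section \<open>Metastability from energy barriers\<close>

text \<open>The target \<open>y\<close> is exempt from \<open>bottom\<close>, so it may lie below
  \<open>x\<close>; this admits the passage from \<open>o\<close> to \<open>e\<close> for odd
  \<open>K * L\<close>. The gap \<open>\<delta>\<close> makes the return to \<open>x\<close> or
  \<open>y\<close> exponentially faster than the passage to \<open>y\<close>.\<close>

theorem metastable_props_of_levels:
  fixes P :: "real \<Rightarrow> 's \<Rightarrow> 's \<Rightarrow> real"
  assumes chain: "\<And>\<beta>. 0 < \<beta> \<Longrightarrow> metropolis X E H N \<beta> (P \<beta>)"
    and x: "x \<in> X" and y: "y \<in> X" and "x \<noteq> y" and \<delta>: "0 < \<delta>" "\<delta> \<le> Gam"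
    and bottom: "\<And>z. z \<in> X - {y} \<Longrightarrow> H x \<le> H z"
    and wells: "\<And>z. z \<in> X - {x, y} \<Longrightarrow> \<exists>a\<in>{x, y}. level_path X E H (H z + Gam - \<delta>) z a"
    and up: "level_path X E H (H x + Gam) x y"
    and barrier: "\<And>h. h < H x + Gam \<Longrightarrow> \<not> level_path X E H h x y"
  shows "metastable_props P X x y Gam"
proof -
  define u where "u \<beta> t = surv (P \<beta>) X {y} t x" for \<beta> t
  define T where "T \<beta> = (\<Sum>k. u \<beta> k)" for \<beta>
  \<comment> \<open>\<open>K1\<close> and \<open>K2\<close> are the prefactors of
    \<open>sum_surv_bound\<close> and \<open>exit_bound\<close>; the added 1 absorbs the additive
    term of the former and makes \<open>K2\<close> at least 1.\<close>
  define K1 where "K1 = 1 + real (card X) ^ 5 * N"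
  define K2 where "K2 = 1 + (real (card X))\<^sup>2 / N"
  define c where "c = 1 / (8 * K2)"
  interpret one: metropolis X E H N 1 "P 1" by (rule chain) simp
  have N: "0 < N" by (rule one.N_pos)
  have K1: "0 < K1" and K2: "1 \<le> K2" using N by (auto simp: K1_def K2_def add_pos_nonneg)
  have c: "0 < c" using K2 by (simp add: c_def)
  have Gam: "0 < Gam" using \<delta> by simp
  have sum_bound: "(\<Sum>k<n. surv (P \<beta>) X A k z) \<le> K1 * exp (\<beta> * D)"
    if "0 < \<beta>" "0 \<le> D" "A \<subseteq> X" "z \<in> X"
      "\<And>z. z \<in> X - A \<Longrightarrow> \<exists>a\<in>A. level_path X E H (H z + D) z a" for \<beta> D A z n
  proof -
    interpret metropolis X E H N \<beta> "P \<beta>" by (rule chain) fact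
    have "(\<Sum>k<n. surv (P \<beta>) X A k z) \<le> 1 + real (card X) ^ 5 * N * exp (\<beta> * D)"
      by (rule sum_surv_bound) (use that in auto)
    also have "\<dots> \<le> 1 * exp (\<beta> * D) + real (card X) ^ 5 * N * exp (\<beta> * D)"
      using that by simp
    finally show ?thesis by (simp add: K1_def algebra_simps)
  qed
  have to_y: "\<exists>a\<in>{y}. level_path X E H (H z + Gam) z a" if z: "z \<in> X - {y}" for z
  proof -
    \<comment> \<open>Here \<open>bottom\<close> enters: since \<open>z\<close> is no lower than
      \<open>x\<close>, the barrier path from \<open>x\<close> stays within height
      \<open>Gam\<close> above \<open>z\<close>.\<close>
    have "level_path X E H (H z + Gam) x y"
      by (rule level_path_mono[OF _ up]) (use bottom[OF z] in simp)
    moreover have "level_path X E H (H z + Gam) z x \<or> level_path X E H (H z + Gam) z y"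
    proof (cases "z = x")
      case False
      then have "z \<in> X - {x, y}" using z by auto
      then obtain a where "a \<in> {x, y}" "level_path X E H (H z + Gam - \<delta>) z a"
        using wells by blast
      moreover from this(2) have "level_path X E H (H z + Gam) z a"
        by (rule level_path_mono[rotated]) (use \<delta> in simp)
      ultimately show ?thesis by auto
    qed simp
    ultimately show ?thesis by (meson rtranclp_trans singletonI)
  qed
  have to_xy: "\<exists>a\<in>{x, y}. level_path X E H (H z + (Gam - \<delta>)) z a" if "z \<in> X - {x, y}" for z
    using wells[OF that] by (simp add: add_diff_eq)
  have sum_y: "(\<Sum>k<n. surv (P \<beta>) X {y} k z) \<le> K1 * exp (\<beta> * Gam)"
    if "0 < \<beta>" "z \<in> X" for \<beta> z n
    by (rule sum_bound) (use that y Gam to_y in auto)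
  have sum_xy: "(\<Sum>k<n. surv (P \<beta>) X {x, y} k z) \<le> K1 * exp (\<beta> * (Gam - \<delta>))"
    if "0 < \<beta>" "z \<in> X" for \<beta> z n
    by (rule sum_bound) (use that x y \<delta> to_xy in auto)
  have summ: "summable (\<lambda>k. surv (P \<beta>) X {y} k z)" if "0 < \<beta>" "z \<in> X" for \<beta> z
  proof -
    interpret metropolis X E H N \<beta> "P \<beta>" by (rule chain) fact
    show ?thesis
      by (rule summableI_nonneg_bounded[OF surv_nonneg[OF that(2)] sum_y[OF that]])
  qed
  have T_le: "T \<beta> \<le> K1 * exp (\<beta> * Gam)" if "0 < \<beta>" for \<beta>
    unfolding T_def u_def by (rule suminf_le_const[OF summ[OF that x] sum_y[OF that x]])
  have u0: "0 \<le> u \<beta> n" if "0 < \<beta>" for \<beta> n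
  proof -
    interpret metropolis X E H N \<beta> "P \<beta>" by (rule chain) fact
    show ?thesis unfolding u_def by (rule surv_nonneg[OF x])
  qed
  have T_ge: "n * u \<beta> n \<le> T \<beta>" and T_ge_Suc: "Suc n * u \<beta> n \<le> T \<beta>" if "0 < \<beta>" for \<beta> n
  proof -
    interpret metropolis X E H N \<beta> "P \<beta>" by (rule chain) fact
    have "n * u \<beta> n \<le> Suc n * u \<beta> n" using u0[OF that] by (intro mult_right_mono) auto
    have "Suc n * u \<beta> n = (\<Sum>k<Suc n. u \<beta> n)" by simp
    also have "\<dots> \<le> (\<Sum>k<Suc n. u \<beta> k)"
      unfolding u_def using surv_antimono[OF x] by (intro sum_mono) auto
    also have "\<dots> \<le> T \<beta>"
      unfolding T_def using summ[OF that x] u0[OF that] by (intro sum_le_suminf) (auto simp: u_def)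
    finally show "Suc n * u \<beta> n \<le> T \<beta>" .
    then show "n * u \<beta> n \<le> T \<beta>" using \<open>n * u \<beta> n \<le> Suc n * u \<beta> n\<close> by linarith
  qed
  have T1: "1 \<le> T \<beta>" if "0 < \<beta>" for \<beta>
    using T_ge_Suc[OF that, of 0] by (simp add: u_def)
  have early: "1 - u \<beta> n \<le> n * (K2 * exp (- \<beta> * Gam))" if b: "0 < \<beta>" for \<beta> n
  proof -
    interpret metropolis X E H N \<beta> "P \<beta>" by (rule chain) fact
    \<comment> \<open>The well of \<open>x\<close>. With the level \<open>h\<close> quantified
      inside, an edge that leaves \<open>C\<close> below the barrier would extend a path at some
      other level below the barrier.\<close>
    define C where "C = {z \<in> X. \<exists>h < H x + Gam. level_path X E H h x z}"
    have "H x < H x + Gam" using Gam by simp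
    then have xC: "x \<in> C" using x unfolding C_def by blast
    have "y \<notin> C" using barrier by (auto simp: C_def)
    then have "1 - u \<beta> n \<le> 1 - surv (P \<beta>) X (X - C) n x"
      unfolding u_def using y by (simp add: surv_antimono_set[OF x])
    also have "\<dots> \<le> n * ((real (card X))\<^sup>2 / N * exp (- \<beta> * (H x + Gam - H x)))"
    proof (rule exit_bound[OF _ xC])
      show "C \<subseteq> X" by (auto simp: C_def)
      fix a b assume a: "a \<in> C" and b: "b \<in> X - C" and E: "E a b"
      obtain h where h: "h < H x + Gam" "level_path X E H h x a" using a by (auto simp: C_def)
      show "H x + Gam \<le> max (H a) (H b)"
      proof (rule ccontr)
        assume n: "\<not> ?thesis"
        let ?h = "max h (max (H a) (H b))"
        have "level_path X E H ?h x a" by (rule level_path_mono[OF _ h(2)]) simp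
        moreover have "level_step X E H ?h a b"
          using a b E by (auto simp: level_step_def C_def)
        ultimately have "level_path X E H ?h x b" by (rule rtranclp.rtrancl_into_rtrancl)
        moreover have "?h < H x + Gam" using n h(1) by (simp add: not_le)
        ultimately have "b \<in> C" using b by (auto simp: C_def)
        then show False using b by simp
      qed
    qed
    also have "\<dots> \<le> n * (K2 * exp (- \<beta> * Gam))"
      by (intro mult_left_mono) (auto simp: K2_def algebra_simps)
    finally show ?thesis .
  qed
  have T_low: "c * exp (\<beta> * Gam) \<le> T \<beta>" if b: "0 < \<beta>" for \<beta>
  proof (cases "2 * K2 \<le> exp (\<beta> * Gam)")
    case True
    \<comment> \<open>Up to time \<open>r\<close> the early-exit bound leaves a survival probability
      of at least 1/2. Rounding down costs another factor 2, so the mean is at least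
      \<open>r / 4\<close>; this is the origin of \<open>c\<close>.\<close>
    define r where "r = exp (\<beta> * Gam) / (2 * K2)"
    have r1: "1 \<le> r" using True K2 by (simp add: r_def)
    define n where "n = nat \<lfloor>r\<rfloor>"
    have "real n \<le> r" "r - 1 \<le> real n" using r1 unfolding n_def by linarith+
    moreover have "1 \<le> n" using r1 le_nat_floor[of 1 r] by (simp add: n_def)
    ultimately have n: "real n \<le> r" "r / 2 \<le> real n" by linarith+
    have "1 - u \<beta> n \<le> n * (K2 * exp (- \<beta> * Gam))" by (rule early[OF b])
    also have "\<dots> \<le> r * (K2 * exp (- \<beta> * Gam))" using n K2 by (intro mult_right_mono) auto
    also have "\<dots> = 1 / 2" using K2 by (simp add: r_def exp_minus)
    finally have "1 / 2 \<le> u \<beta> n" by simp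
    then have "r / 2 * (1 / 2) \<le> n * u \<beta> n" using n r1 by (intro mult_mono) auto
    then show ?thesis using T_ge[OF b, of n] K2 by (simp add: r_def c_def)
  next
    case False
    then have "c * exp (\<beta> * Gam) \<le> 1" using K2 by (simp add: c_def)
    then show ?thesis using T1[OF b] by simp
  qed
  have mean: "(\<lambda>t. real t * hit_pmf (P \<beta>) X {y} x t) sums T \<beta>" if "0 < \<beta>" for \<beta>
  proof -
    interpret metropolis X E H N \<beta> "P \<beta>" by (rule chain) fact
    show ?thesis unfolding T_def u_def by (rule sums_hit_mean[OF x summ[OF that x]])
  qed
  then have hit_mean: "hit_mean (P \<beta>) X {y} x = T \<beta>" if "0 < \<beta>" for \<beta>
    using that by (simp add: hit_mean_def sums_iff)
  have pos: "\<forall>\<^sub>F \<beta>::real in at_top. 0 < \<beta>" by (rule eventually_gt_at_top)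
  have expo: "filterlim (\<lambda>\<beta>. exp (\<beta> * a)) at_top at_top" if "0 < a" for a :: real
    using that by real_asymp
  have expo0: "((\<lambda>\<beta>. K * exp (- \<beta> * a)) \<longlongrightarrow> 0) at_top" if "0 < a" for a K :: real
    using that by real_asymp

  have summable_mean: "\<forall>\<beta>>0. summable (\<lambda>t. real t * hit_pmf (P \<beta>) X {y} x t)"
    using mean sums_summable by blast

  have window: "((\<lambda>\<beta>. hit_prob_between (P \<beta>) X {y} x (exp (\<beta> * (Gam - \<epsilon>))) (exp (\<beta> * (Gam + \<epsilon>))))
      \<longlongrightarrow> 1) at_top" if \<epsilon>: "0 < \<epsilon>" for \<epsilon>
  proof (rule tendsto_sandwich[where f = "\<lambda>\<beta>. 1 - K2 * exp (- \<beta> * \<epsilon>) - K1 * exp (- \<beta> * \<epsilon>)"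
        and h = "\<lambda>_. 1"])
    have "((\<lambda>\<beta>. 1 - K2 * exp (- \<beta> * \<epsilon>) - K1 * exp (- \<beta> * \<epsilon>)) \<longlongrightarrow> 1 - 0 - 0) at_top"
      by (intro tendsto_diff expo0 \<epsilon> tendsto_const)
    then show "((\<lambda>\<beta>. 1 - K2 * exp (- \<beta> * \<epsilon>) - K1 * exp (- \<beta> * \<epsilon>)) \<longlongrightarrow> 1) at_top" by simp
    \<comment> \<open>\<open>hit_prob_between_eq\<close> asks for a window of length at least
      1.\<close>
    have "\<forall>\<^sub>F \<beta> in at_top. exp (- \<beta> * \<epsilon>) + 1 \<le> exp (\<beta> * \<epsilon>)" using \<epsilon> by real_asymp
    with pos have "\<forall>\<^sub>F \<beta> in at_top. exp (\<beta> * (Gam - \<epsilon>)) + 1 \<le> exp (\<beta> * (Gam + \<epsilon>))"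
    proof eventually_elim
      case (elim \<beta>)
      have "1 \<le> exp (\<beta> * Gam)" using elim Gam by simp
      then have "exp (\<beta> * (Gam - \<epsilon>)) + 1 \<le> exp (\<beta> * Gam) * (exp (- \<beta> * \<epsilon>) + 1)"
        by (simp add: exp_add[symmetric] algebra_simps)
      also have "\<dots> \<le> exp (\<beta> * Gam) * exp (\<beta> * \<epsilon>)" using elim by (intro mult_left_mono) auto
      finally show ?case by (simp add: exp_add[symmetric] algebra_simps)
    qed
    with pos have "\<forall>\<^sub>F \<beta> in at_top.
      1 - K2 * exp (- \<beta> * \<epsilon>) - K1 * exp (- \<beta> * \<epsilon>) \<le>
        hit_prob_between (P \<beta>) X {y} x (exp (\<beta> * (Gam - \<epsilon>))) (exp (\<beta> * (Gam + \<epsilon>))) \<and>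
      hit_prob_between (P \<beta>) X {y} x (exp (\<beta> * (Gam - \<epsilon>))) (exp (\<beta> * (Gam + \<epsilon>))) \<le> 1"
    proof eventually_elim
      case (elim \<beta>)
      interpret metropolis X E H N \<beta> "P \<beta>" by (rule chain) fact
      let ?a = "exp (\<beta> * (Gam - \<epsilon>))" and ?b = "exp (\<beta> * (Gam + \<epsilon>))"
      define p where "p = nat \<lfloor>?a\<rfloor>"
      define r where "r = nat (\<lceil>?b\<rceil> - 1)"
      have eq: "hit_prob_between (P \<beta>) X {y} x ?a ?b = u \<beta> p - u \<beta> r"
        unfolding u_def p_def r_def by (rule hit_prob_between_eq) (use elim in auto)
      have "real p \<le> ?a" unfolding p_def by (simp add: of_nat_floor)
      have "1 - u \<beta> p \<le> p * (K2 * exp (- \<beta> * Gam))" by (rule early) fact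
      also have "\<dots> \<le> ?a * (K2 * exp (- \<beta> * Gam))"
        using \<open>real p \<le> ?a\<close> K2 by (intro mult_right_mono) auto
      also have "\<dots> = K2 * exp (- \<beta> * \<epsilon>)"
        by (simp add: exp_add[symmetric] mult.left_commute algebra_simps)
      finally have up: "1 - u \<beta> p \<le> K2 * exp (- \<beta> * \<epsilon>)" .
      have "0 < ?b" by simp
      \<comment> \<open>\<open>r\<close> itself lies below \<open>?b\<close>, hence Markov's
        inequality is taken in the form with \<open>Suc r\<close>.\<close>
      then have "?b \<le> Suc r" unfolding r_def by linarith
      then have "?b * u \<beta> r \<le> Suc r * u \<beta> r" using u0[OF elim(1)] by (intro mult_right_mono) auto
      also have "\<dots> \<le> K1 * exp (\<beta> * Gam)"
        using T_ge_Suc[OF elim(1), of r] T_le[OF elim(1)] by linarith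
      finally have "u \<beta> r \<le> K1 * exp (\<beta> * Gam) / ?b" by (simp add: field_simps)
      also have "\<dots> = K1 * exp (- \<beta> * \<epsilon>)"
        unfolding times_divide_eq_right[symmetric] exp_diff[symmetric] by (simp add: algebra_simps)
      finally have "u \<beta> r \<le> K1 * exp (- \<beta> * \<epsilon>)" .
      moreover have "u \<beta> p \<le> 1" unfolding u_def by (rule surv_le_1[OF x])
      ultimately show ?case using up u0[OF elim(1), of r] unfolding eq by linarith
    qed
    then show "\<forall>\<^sub>F \<beta> in at_top. 1 - K2 * exp (- \<beta> * \<epsilon>) - K1 * exp (- \<beta> * \<epsilon>) \<le>
        hit_prob_between (P \<beta>) X {y} x (exp (\<beta> * (Gam - \<epsilon>))) (exp (\<beta> * (Gam + \<epsilon>)))"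
      and "\<forall>\<^sub>F \<beta> in at_top.
        hit_prob_between (P \<beta>) X {y} x (exp (\<beta> * (Gam - \<epsilon>))) (exp (\<beta> * (Gam + \<epsilon>))) \<le> 1"
      by (auto elim: eventually_mono)
  qed simp

  have log_mean: "((\<lambda>\<beta>. ln (hit_mean (P \<beta>) X {y} x) / \<beta>) \<longlongrightarrow> Gam) at_top"
  proof (rule tendsto_sandwich[where f = "\<lambda>\<beta>. (ln c + \<beta> * Gam) / \<beta>"
        and h = "\<lambda>\<beta>. (ln K1 + \<beta> * Gam) / \<beta>"])
    show "((\<lambda>\<beta>. (ln c + \<beta> * Gam) / \<beta>) \<longlongrightarrow> Gam) at_top" by real_asymp
    show "((\<lambda>\<beta>. (ln K1 + \<beta> * Gam) / \<beta>) \<longlongrightarrow> Gam) at_top" by real_asymp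
    have "\<forall>\<^sub>F \<beta> in at_top. (ln c + \<beta> * Gam) / \<beta> \<le> ln (hit_mean (P \<beta>) X {y} x) / \<beta> \<and>
      ln (hit_mean (P \<beta>) X {y} x) / \<beta> \<le> (ln K1 + \<beta> * Gam) / \<beta>"
      using pos
    proof eventually_elim
      case (elim \<beta>)
      have "ln (c * exp (\<beta> * Gam)) \<le> ln (T \<beta>)" "ln (T \<beta>) \<le> ln (K1 * exp (\<beta> * Gam))"
        using T_low[OF elim] T_le[OF elim] T1[OF elim] c by (simp_all add: ln_le_cancel_iff K1)
      then show ?case
        using elim c K1 by (auto simp: hit_mean ln_mult intro!: divide_right_mono)
    qed
    then show "\<forall>\<^sub>F \<beta> in at_top. (ln c + \<beta> * Gam) / \<beta> \<le> ln (hit_mean (P \<beta>) X {y} x) / \<beta>"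
      and "\<forall>\<^sub>F \<beta> in at_top. ln (hit_mean (P \<beta>) X {y} x) / \<beta> \<le> (ln K1 + \<beta> * Gam) / \<beta>"
      by (auto elim: eventually_mono)
  qed

  define K3 where "K3 = 2 / c + K1 + K1 / c"
  have geometric: "\<bar>u \<beta> t - (1 - 1 / T \<beta>) ^ t\<bar> \<le> 2 * K3 * exp (- \<beta> * (\<delta> / 2))"
    if b: "0 < \<beta>" for \<beta> t
  proof -
    interpret metropolis X E H N \<beta> "P \<beta>" by (rule chain) fact
    \<comment> \<open>On the exponential scale \<open>R\<close> is halfway between the return time
      \<open>exp (\<beta> * (Gam - \<delta>))\<close> and \<open>T \<beta>\<close>, so both
      \<open>C / R\<close> and \<open>R / T \<beta>\<close> are of order
      \<open>exp (- \<beta> * \<delta> / 2)\<close>.\<close>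
    define R where "R = nat \<lceil>exp (\<beta> * (Gam - \<delta> / 2))\<rceil>"
    define C where "C = K1 * exp (\<beta> * (Gam - \<delta>))"
    define e where "e = exp (- \<beta> * (\<delta> / 2))"
    have e: "0 < e" "e \<le> 1" using b \<delta> by (auto simp: e_def)
    have ge1: "1 \<le> exp (\<beta> * (Gam - \<delta> / 2))" using b \<delta> by simp
    have R: "exp (\<beta> * (Gam - \<delta> / 2)) \<le> R" "R \<le> 2 * exp (\<beta> * (Gam - \<delta> / 2))" "0 < R"
      using ge1 unfolding R_def by linarith+
    have Re: "exp (\<beta> * (Gam - \<delta> / 2)) = exp (\<beta> * Gam) * e"
      by (simp add: e_def exp_add[symmetric] algebra_simps)
    have Ce: "exp (\<beta> * (Gam - \<delta>)) = exp (\<beta> * (Gam - \<delta> / 2)) * e"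
      by (simp add: e_def exp_add[symmetric] algebra_simps)
    have T0: "0 < T \<beta>" using T1[OF b] by simp
    have cT: "exp (\<beta> * Gam) \<le> T \<beta> / c" using T_low[OF b] c by (simp add: field_simps)
    have "real R \<le> 2 * (T \<beta> / c * e)"
      using R(2) cT e mult_right_mono[OF cT, of e] unfolding Re by linarith
    then have 1: "R / T \<beta> \<le> 2 / c * e" using T0 c by (simp add: field_simps)
    have "C \<le> K1 * (real R * e)"
      unfolding C_def Ce using R(1) K1 e by (intro mult_left_mono mult_right_mono) auto
    then have 2: "C / R \<le> K1 * e" using R(3) by (simp add: field_simps)
    have "exp (\<beta> * (Gam - \<delta> / 2)) * e \<le> (T \<beta> / c * 1) * e"
      unfolding Re using cT e T0 c by (intro mult_right_mono mult_mono) auto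
    then have "C \<le> K1 * (T \<beta> / c * e)"
      unfolding C_def Ce using K1 by (intro mult_left_mono) auto
    then have 3: "C / T \<beta> \<le> K1 / c * e" using T0 by (simp add: field_simps)
    have "\<bar>u \<beta> t - (1 - 1 / T \<beta>) ^ t\<bar> \<le> 2 * (R / T \<beta> + C / R + C / T \<beta>)"
      unfolding u_def
      by (rule surv_close_to_geometric[OF x \<open>x \<noteq> y\<close>])
        (use summ[OF b] sum_xy[OF b] R(3) in \<open>auto simp: T_def u_def C_def\<close>)
    also have "\<dots> \<le> 2 * (2 / c * e + K1 * e + K1 / c * e)"
      using 1 2 3 by (intro mult_left_mono add_mono) auto
    also have "\<dots> = 2 * (K3 * e)" by (simp add: K3_def distrib_right)
    finally show ?thesis by (simp add: e_def)
  qed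
  have T_top: "filterlim T at_top at_top"
  proof (rule filterlim_at_top_mono)
    show "filterlim (\<lambda>\<beta>. c * exp (\<beta> * Gam)) at_top at_top" using c Gam by real_asymp
    show "\<forall>\<^sub>F \<beta> in at_top. c * exp (\<beta> * Gam) \<le> T \<beta>"
      using pos by eventually_elim (rule T_low)
  qed
  have law: "((\<lambda>\<beta>. hit_scaled_cdf (P \<beta>) X {y} x s) \<longlongrightarrow> exp1_cdf s) at_top" for s
  proof (cases "s < 0")
    case True
    have "\<forall>\<^sub>F \<beta> in at_top. hit_scaled_cdf (P \<beta>) X {y} x s = 0"
      using pos
    proof eventually_elim
      case (elim \<beta>)
      interpret metropolis X E H N \<beta> "P \<beta>" by (rule chain) fact
      show ?case by (rule hit_scaled_cdf_neg) (use True T1[OF elim] hit_mean[OF elim] in auto)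
    qed
    then show ?thesis using True by (simp add: exp1_cdf_def tendsto_eventually)
  next
    case False
    let ?t = "\<lambda>\<beta>. nat \<lfloor>s * T \<beta>\<rfloor>"
    have geo: "((\<lambda>\<beta>. (1 - 1 / T \<beta>) ^ ?t \<beta>) \<longlongrightarrow> exp (- s)) at_top"
      by (rule filterlim_compose[OF geometric_tendsto_exp T_top]) (use False in simp)
    have "((\<lambda>\<beta>. u \<beta> (?t \<beta>) - (1 - 1 / T \<beta>) ^ ?t \<beta>) \<longlongrightarrow> 0) at_top"
    proof (rule Lim_null_comparison)
      show "\<forall>\<^sub>F \<beta> in at_top. norm (u \<beta> (?t \<beta>) - (1 - 1 / T \<beta>) ^ ?t \<beta>) \<le>
          2 * K3 * exp (- \<beta> * (\<delta> / 2))"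
        using pos by eventually_elim (simp only: real_norm_def geometric)
      show "((\<lambda>\<beta>. 2 * K3 * exp (- \<beta> * (\<delta> / 2))) \<longlongrightarrow> 0) at_top"
        by (rule expo0) (use \<delta> in simp)
    qed
    from tendsto_add[OF this geo] have "((\<lambda>\<beta>. u \<beta> (?t \<beta>)) \<longlongrightarrow> exp (- s)) at_top" by simp
    then have "((\<lambda>\<beta>. 1 - u \<beta> (?t \<beta>)) \<longlongrightarrow> exp1_cdf s) at_top"
      using False by (auto simp: exp1_cdf_def intro!: tendsto_intros)
    moreover have "\<forall>\<^sub>F \<beta> in at_top. 1 - u \<beta> (?t \<beta>) = hit_scaled_cdf (P \<beta>) X {y} x s"
      using pos
    proof eventually_elim
      case (elim \<beta>)
      interpret metropolis X E H N \<beta> "P \<beta>" by (rule chain) fact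
      show ?case
        unfolding u_def
        by (rule hit_scaled_cdf_eq[symmetric]) (use False T1[OF elim] hit_mean[OF elim] in auto)
    qed
    ultimately show ?thesis by (rule Lim_transform_eventually)
  qed
  show ?thesis
    unfolding metastable_props_def using summable_mean window log_mean law by blast
qed

section \<open>Particle moves on bipartite graphs\<close>

definition flip :: "'v set \<Rightarrow> 'v set \<Rightarrow> bool" where
  "flip S S' \<longleftrightarrow> card ((S - S') \<union> (S' - S)) = 1"

lemma flip_insert: "v \<notin> S \<Longrightarrow> flip S (insert v S)"
  by (auto simp: flip_def insert_Diff_if)

lemma flip_remove: "v \<in> S \<Longrightarrow> flip S (S - {v})"
proof -
  assume "v \<in> S"
  then have "S - (S - {v}) \<union> (S - {v} - S) = {v}" by auto
  then show ?thesis by (simp add: flip_def)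
qed

lemma flipE:
  assumes "flip S S'"
  obtains v where "v \<notin> S" "S' = insert v S" | v where "v \<in> S" "S' = S - {v}"
proof -
  obtain v where v: "(S - S') \<union> (S' - S) = {v}"
    using assms unfolding flip_def by (rule card_1_singletonE)
  have iff: "x \<in> S' \<longleftrightarrow> (x \<in> S) \<noteq> (x = v)" for x
    using arg_cong[OF v, of "\<lambda>A. x \<in> A"] by auto
  show thesis
  proof (cases "v \<in> S")
    case True
    then have "S' = S - {v}" by (auto simp: set_eq_iff iff)
    then show thesis by (rule that(2)[OF True])
  next
    case False
    then have "S' = insert v S" by (auto simp: set_eq_iff iff)
    then show thesis by (rule that(1)[OF False])
  qed
qed

locale bipartite_graph =
  fixes V :: "'v set" and white :: "'v \<Rightarrow> bool" and adj :: "'v \<Rightarrow> 'v \<Rightarrow> bool"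
  assumes finite_V: "finite V"
    and adj_sym: "adj v w \<Longrightarrow> adj w v"
    and adj_white: "v \<in> V \<Longrightarrow> w \<in> V \<Longrightarrow> adj v w \<Longrightarrow> white v \<noteq> white w"
begin

definition Wh :: "'v set" where "Wh = {v \<in> V. white v}"
definition Bl :: "'v set" where "Bl = {v \<in> V. \<not> white v}"
definition indep :: "'v set set" where
  "indep = {S. S \<subseteq> V \<and> (\<forall>v\<in>S. \<forall>w\<in>S. \<not> adj v w)}"

text \<open>Energy is minus the particle number, so at least \<open>m\<close> particles are present
  all along. \<open>m\<close> is real, which keeps \<open>card S - d\<close> from being truncated at
  0.\<close>

abbreviation reach :: "real \<Rightarrow> 'v set \<Rightarrow> 'v set \<Rightarrow> bool" where
  "reach m \<equiv> level_path indep flip (\<lambda>S. - real (card S)) (- m)"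

lemma indep_finite: "S \<in> indep \<Longrightarrow> finite S"
  using finite_V finite_subset by (auto simp: indep_def)

lemma indep_subset: "S \<in> indep \<Longrightarrow> T \<subseteq> S \<Longrightarrow> T \<in> indep"
  by (auto simp: indep_def)

lemma indep_insert:
  assumes "S \<in> indep" "v \<in> V" "\<And>w. w \<in> S \<Longrightarrow> \<not> adj v w"
  shows "insert v S \<in> indep"
  using assms adj_sym adj_white[of v v] by (auto simp: indep_def)

lemma finite_indep: "finite indep"
  using finite_V by (auto simp: indep_def intro: finite_subset[OF _ finite_Pow_iff[THEN iffD2]])

lemma Wh_indep: "Wh \<in> indep" and Bl_indep: "Bl \<in> indep"
  using adj_white by (auto simp: Wh_def Bl_def indep_def)

lemma reach_indep: "reach m S T \<Longrightarrow> S \<in> indep \<Longrightarrow> T \<in> indep"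
  by (induction rule: rtranclp_induct) (auto simp: level_step_def)

lemma reach_sym: "reach m S T \<Longrightarrow> reach m T S"
  by (rule sympD[OF symp_rtranclp])
    (auto intro!: sympI simp: level_step_def flip_def Un_commute)

lemma reach_weaken: "reach m S T \<Longrightarrow> (m'::real) \<le> m \<Longrightarrow> reach m' S T"
  by (rule level_path_mono) auto

lemma reach_insert:
  fixes m :: real
  assumes "S \<in> indep" "v \<in> V" "v \<notin> S" "\<And>w. w \<in> S \<Longrightarrow> \<not> adj v w" "m \<le> card S"
  shows "reach m S (insert v S)"
  using assms indep_insert[of S v] indep_finite[of S] flip_insert[of v S]
  by (intro r_into_rtranclp) (auto simp: level_step_def)

lemma reach_remove:
  fixes m :: real
  assumes "S \<in> indep" "v \<in> S" "m + 1 \<le> card S"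
  shows "reach m S (S - {v})"
proof (rule r_into_rtranclp)
  have c: "card S = Suc (card (S - {v}))"
    by (rule card_Suc_Diff1[OF indep_finite[OF assms(1)] assms(2), symmetric])
  have "S - {v} \<in> indep" by (rule indep_subset[OF assms(1)]) auto
  moreover have "S \<noteq> S - {v}" using assms(2) by auto
  moreover have "m \<le> card (S - {v})" using assms(3) c by linarith
  moreover have "m \<le> card S" using assms(3) by linarith
  ultimately show "level_step indep flip (\<lambda>S. - real (card S)) (- m) S (S - {v})"
    unfolding level_step_def using assms(1) flip_remove[OF assms(2)] by simp
qed

lemma reach_swap:
  fixes m :: real
  assumes S: "S \<in> indep" and v: "v \<in> S" and w: "w \<in> V" "w \<notin> S"
    and adj: "\<And>z. z \<in> S \<Longrightarrow> adj w z \<Longrightarrow> z = v" and m: "m + 1 \<le> card S"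
  shows "reach m S (insert w (S - {v}))" "card (insert w (S - {v})) = card S"
proof -
  have fin: "finite S" by (rule indep_finite[OF S])
  have c: "card S = Suc (card (S - {v}))" by (rule card_Suc_Diff1[OF fin v, symmetric])
  show "card (insert w (S - {v})) = card S" using w fin c by simp
  have "reach m S (S - {v})" by (rule reach_remove) fact+
  also have "reach m (S - {v}) (insert w (S - {v}))"
  proof (rule reach_insert[OF _ w(1)])
    show "S - {v} \<in> indep" by (rule indep_subset[OF S]) auto
    show "w \<notin> S - {v}" using w(2) by simp
    show "\<not> adj w z" if "z \<in> S - {v}" for z using adj that by blast
    show "m \<le> card (S - {v})" using m c by linarith
  qed
  finally show "reach m S (insert w (S - {v}))" .
qed

lemma reach_empty: "S \<in> indep \<Longrightarrow> reach 0 S {}"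
proof (induction "card S" arbitrary: S)
  case 0
  then show ?case using indep_finite by auto
next
  case (Suc n)
  then obtain v where v: "v \<in> S" by (metis card.empty equals0I nat.distinct(1))
  have "card S = Suc (card (S - {v}))"
    by (rule card_Suc_Diff1[OF indep_finite[OF Suc.prems] v, symmetric])
  then have "n = card (S - {v})" using Suc.hyps(2) by linarith
  moreover have "S - {v} \<in> indep" by (rule indep_subset[OF Suc.prems]) auto
  ultimately have "reach 0 (S - {v}) {}" by (rule Suc.hyps(1))
  moreover have "reach 0 S (S - {v})"
    by (rule reach_remove[OF Suc.prems v]) (use Suc.hyps(2) in linarith)
  ultimately show ?case by (rule rtranclp_trans[rotated])
qed

lemma white_neighbours: "S \<subseteq> V \<Longrightarrow> w \<in> Bl \<Longrightarrow> z \<in> S \<Longrightarrow> adj w z \<Longrightarrow> z \<in> S \<inter> Wh"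
  and black_neighbours: "S \<subseteq> V \<Longrightarrow> w \<in> Wh \<Longrightarrow> z \<in> S \<Longrightarrow> adj w z \<Longrightarrow> z \<in> S \<inter> Bl"
  using adj_white by (auto simp: Wh_def Bl_def)

text \<open>What a failure of the depth bound looks like: with at most \<open>d\<close> particles
  missing, neither a gain nor a full chessboard can be reached. By the empty path \<open>Wh\<close>
  and \<open>Bl\<close> are never trapped.\<close>

definition trapped :: "nat \<Rightarrow> 'v set \<Rightarrow> bool" where
  "trapped d S \<longleftrightarrow> S \<in> indep \<and>
     (\<forall>T. reach (real (card S) - real d) S T \<longrightarrow> card T \<le> card S \<and> T \<noteq> Wh \<and> T \<noteq> Bl)"

definition plateau :: "nat \<Rightarrow> 'v set \<Rightarrow> 'v set set" where
  "plateau d S = {T. reach (real (card S) - real d) S T \<and> card T = card S}"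

lemma plateauD:
  assumes "T \<in> plateau d S" "S \<in> indep"
  shows "T \<in> indep" "reach (real (card S) - real d) S T" "card T = card S" "finite T" "T \<subseteq> V"
proof -
  show r: "reach (real (card S) - real d) S T" and "card T = card S"
    using assms(1) unfolding plateau_def by blast+
  show "T \<in> indep" by (rule reach_indep[OF r assms(2)])
  then show "finite T" "T \<subseteq> V" using indep_finite unfolding indep_def by blast+
qed

lemma plateauI: "reach (real (card S) - real d) S T \<Longrightarrow> card T = card S \<Longrightarrow> T \<in> plateau d S"
  unfolding plateau_def by blast

text \<open>
  First push the white part down as far as swaps allow, which yields \<open>A\<close>; then, keeping \<open>A\<close>, push the
  black part down, which yields \<open>B\<close>.
\<close>
lemma trapped_core:
  assumes S: "trapped d S" and d: "1 \<le> d"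
  obtains A B T where "T \<in> plateau d S" "A = T \<inter> Wh" "B \<subseteq> Bl" "A \<noteq> {}" "B \<noteq> {}"
    "A \<union> B \<in> indep"
    "\<And>T'. T' \<in> plateau d S \<Longrightarrow> \<not> T' \<inter> Wh \<subset> A"
    "\<And>w v. w \<in> Bl \<Longrightarrow> {z \<in> A. adj w z} \<noteq> {v}"
    "\<And>w v. w \<in> Wh \<Longrightarrow> {z \<in> B. adj w z} \<noteq> {v}"
proof -
  let ?m = "real (card S) - real d"
  have SX: "S \<in> indep" using S by (simp add: trapped_def)
  note plat = plateauD[OF _ SX]
  have no_add: "\<exists>z\<in>T. adj w z" if T: "T \<in> plateau d S" and w: "w \<in> V" "w \<notin> T" for T w
  proof (rule ccontr)
    assume "\<not> ?thesis"
    then have "reach ?m T (insert w T)"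
      using plat[OF T] w d by (intro reach_insert) auto
    then have "reach ?m S (insert w T)" by (rule rtranclp_trans[OF plat(2)[OF T]])
    then have "card (insert w T) \<le> card S" using S unfolding trapped_def by blast
    then show False using plat(3,4)[OF T] w by simp
  qed
  have swap: "insert w (T - {v}) \<in> plateau d S"
    if T: "T \<in> plateau d S" and v: "v \<in> T" and w: "w \<in> V" "w \<notin> T"
      "\<And>z. z \<in> T \<Longrightarrow> adj w z \<Longrightarrow> z = v" for T v w
  proof -
    have "reach ?m T (insert w (T - {v}))" "card (insert w (T - {v})) = card T"
      using reach_swap[of T v w ?m] plat[OF T] v w d by auto
    then show ?thesis
      using rtranclp_trans[OF plat(2)[OF T]] plat(3)[OF T] by (intro plateauI) auto
  qed
  have "S \<in> plateau d S" by (simp add: plateau_def)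
  then obtain T where T: "T \<in> plateau d S"
    and T_min: "\<And>T'. T' \<in> plateau d S \<Longrightarrow> card (T \<inter> Wh) \<le> card (T' \<inter> Wh)"
    using ex_has_least_nat[of "\<lambda>T. T \<in> plateau d S" S "\<lambda>T. card (T \<inter> Wh)"] by blast
  define A where "A = T \<inter> Wh"
  obtain T' where T': "T' \<in> plateau d S" "A \<subseteq> T'"
    and T'_min: "\<And>T''. T'' \<in> plateau d S \<Longrightarrow> A \<subseteq> T'' \<Longrightarrow> card (T' \<inter> Bl) \<le> card (T'' \<inter> Bl)"
    using ex_has_least_nat[of "\<lambda>T'. T' \<in> plateau d S \<and> A \<subseteq> T'" T "\<lambda>T. card (T \<inter> Bl)"] T
    by (auto simp: A_def)
  define B where "B = T' \<inter> Bl"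
  note pT = plat[OF T] and pT' = plat[OF T'(1)]
  have part: "V = Wh \<union> Bl" "Wh \<inter> Bl = {}" by (auto simp: Wh_def Bl_def)
  have neq: "U \<noteq> Wh" "U \<noteq> Bl" if "U \<in> plateau d S" for U
    using S plat(2)[OF that] unfolding trapped_def by blast+
  \<comment> \<open>Without white particles \<open>T\<close> would be a proper subset of
    \<open>Bl\<close>, and an empty black site could be filled, contrary to
    \<open>no_add\<close>.\<close>
  have "A \<noteq> {}"
  proof
    assume "A = {}"
    then have "T \<subset> Bl" using pT neq(2)[OF T] part by (auto simp: A_def)
    then obtain w where w: "w \<in> Bl" "w \<notin> T" by auto
    then obtain z where "z \<in> T" "adj w z" using no_add[OF T] part by blast
    then show False using white_neighbours[OF pT(5) w(1)] \<open>A = {}\<close> by (auto simp: A_def)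
  qed
  moreover have "B \<noteq> {}"
  proof
    assume "B = {}"
    then have "T' \<subset> Wh" using pT' neq(1)[OF T'(1)] part by (auto simp: B_def)
    then obtain w where w: "w \<in> Wh" "w \<notin> T'" by auto
    then obtain z where "z \<in> T'" "adj w z" using no_add[OF T'(1)] part by blast
    then show False using black_neighbours[OF pT'(5) w(1)] \<open>B = {}\<close> by (auto simp: B_def)
  qed
  moreover have "{z \<in> A. adj w z} \<noteq> {v}" if w: "w \<in> Bl" for w v
  proof
    assume e: "{z \<in> A. adj w z} = {v}"
    then have v: "v \<in> T" "v \<in> Wh" "adj w v" by (auto simp: A_def)
    then have "w \<notin> T" using pT(1) by (auto simp: indep_def)
    then have "insert w (T - {v}) \<in> plateau d S"
      using w v e white_neighbours[OF pT(5) w] part by (intro swap[OF T]) (auto simp: A_def)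
    then have "card (T \<inter> Wh) \<le> card (insert w (T - {v}) \<inter> Wh)" by (rule T_min)
    moreover have "insert w (T - {v}) \<inter> Wh = (T \<inter> Wh) - {v}" using w part by auto
    moreover have "card (T \<inter> Wh - {v}) < card (T \<inter> Wh)"
      by (rule card_Diff1_less) (use v pT(4) in auto)
    ultimately show False by (metis leD)
  qed
  moreover have "{z \<in> B. adj w z} \<noteq> {v}" if w: "w \<in> Wh" for w v
  proof
    assume e: "{z \<in> B. adj w z} = {v}"
    then have v: "v \<in> T'" "v \<in> Bl" "adj w v" by (auto simp: B_def)
    then have "w \<notin> T'" using pT'(1) by (auto simp: indep_def)
    then have "insert w (T' - {v}) \<in> plateau d S"
      using w v e black_neighbours[OF pT'(5) w] part by (intro swap[OF T'(1)]) (auto simp: B_def)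
    \<comment> \<open>The swap trades a black particle for a white one, so \<open>A\<close> survives
      and the new configuration competes with \<open>T'\<close>.\<close>
    moreover have "A \<subseteq> insert w (T' - {v})" using T'(2) v part by (auto simp: A_def)
    ultimately have "card (T' \<inter> Bl) \<le> card (insert w (T' - {v}) \<inter> Bl)" by (rule T'_min)
    moreover have "insert w (T' - {v}) \<inter> Bl = (T' \<inter> Bl) - {v}" using w part by auto
    moreover have "card (T' \<inter> Bl - {v}) < card (T' \<inter> Bl)"
      by (rule card_Diff1_less) (use v pT'(4) in auto)
    ultimately show False by (metis leD)
  qed
  moreover have "A \<union> B \<in> indep"
    using T'(2) by (intro indep_subset[OF pT'(1)]) (auto simp: B_def)
  moreover have "\<not> U \<inter> Wh \<subset> A" if "U \<in> plateau d S" for U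
    using T_min[OF that] pT(4) psubset_card_mono[of A "U \<inter> Wh"] by (auto simp: A_def)
  ultimately show thesis
    using T by (intro that[of T A B]) (auto simp: A_def B_def)
qed

text \<open>
  After removing \<open>a 0\<close>, the particles of the line can be swapped away one by one. When the last one
  goes, both black sites next to it become free, which makes up for the removal.
\<close>
lemma trapped_no_line:
  assumes S: "trapped d S" and d: "2 \<le> d" and T: "T \<in> plateau d S"
    and min: "\<And>U. U \<in> plateau d S \<Longrightarrow> \<not> U \<inter> Wh \<subset> T \<inter> Wh"
    and a: "\<And>n::nat. a n \<in> T \<inter> Wh" and w: "\<And>n. w n \<in> Bl"
    and aw: "\<And>n. {z \<in> T \<inter> Wh. adj (w n) z} = {a n, a (Suc n)}"
    and a_neq: "\<And>n. a n \<noteq> a (Suc n)" and w_neq: "\<And>n. w n \<noteq> w (Suc n)"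
  shows False
proof -
  let ?m = "real (card S) - real d"
  have SX: "S \<in> indep" using S by (simp add: trapped_def)
  note TX = plateauD[OF T SX]
  define Q where "Q U \<longleftrightarrow> reach ?m S U \<and> Suc (card U) = card S \<and> U \<inter> Wh \<subseteq> T \<inter> Wh \<and>
    a 0 \<notin> U \<and> U \<inter> range a \<noteq> {}" for U
  have part: "V = Wh \<union> Bl" "Wh \<inter> Bl = {}" by (auto simp: Wh_def Bl_def)
  have "Q (T - {a 0})"
  proof -
    have "reach ?m T (T - {a 0})" by (rule reach_remove[OF TX(1)]) (use TX(3) a[of 0] d in auto)
    then have "reach ?m S (T - {a 0})" by (rule rtranclp_trans[OF TX(2)])
    moreover have "Suc (card (T - {a 0})) = card S"
      using card_Suc_Diff1[OF TX(4), of "a 0"] a[of 0] TX(3) by auto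
    moreover have "a 1 \<in> T - {a 0}" using a[of 1] a_neq[of 0] by auto
    ultimately show ?thesis unfolding Q_def by blast
  qed
  \<comment> \<open>Instead of following the swaps one at a time, take a state with the fewest white
    particles among those with some of the line left; the next swap must then empty the
    line.\<close>
  then obtain U where U: "Q U" and U_min: "\<And>U'. Q U' \<Longrightarrow> card (U \<inter> Wh) \<le> card (U' \<inter> Wh)"
    using ex_has_least_nat[of Q _ "\<lambda>U. card (U \<inter> Wh)"] by blast
  have U_reach: "reach ?m S U" and UX: "Suc (card U) = card S" "U \<inter> Wh \<subseteq> T \<inter> Wh" "a 0 \<notin> U"
    using U unfolding Q_def by blast+
  have U_indep: "U \<in> indep" by (rule reach_indep[OF U_reach SX])
  have UV: "U \<subseteq> V" and finU: "finite U" using U_indep indep_finite unfolding indep_def by blast+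
  obtain j where "a j \<in> U" using U unfolding Q_def by blast
  \<comment> \<open>A place where an empty line site is followed by an occupied one:
    \<open>a (Suc i)\<close> alone blocks \<open>w i\<close>.\<close>
  then obtain i where i: "a i \<notin> U" "a (Suc i) \<in> U"
    using UX(3) by (induction j) blast+
  have adj_w: "adj (w n) (a n)" "adj (w n) (a (Suc n))" for n using aw[of n] by blast+
  have w_nbr: "z = a n \<or> z = a (Suc n)" if "z \<in> W" "adj (w n) z" "W \<subseteq> V" "W \<inter> Wh \<subseteq> T \<inter> Wh" for W z n
    using white_neighbours[OF that(3) w that(1,2)] that(2,4) aw[of n] by blast
  have wU: "w i \<notin> U" "w (Suc i) \<notin> U"
    using U_indep adj_w(2)[of i] adj_w(1)[of "Suc i"] i(2) unfolding indep_def by blast+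
  define U1 where "U1 = insert (w i) (U - {a (Suc i)})"
  have r1: "reach ?m U U1" "card U1 = card U"
  proof -
    have 1: "w i \<in> V" using w part by blast
    have 2: "z = a (Suc i)" if "z \<in> U" "adj (w i) z" for z
      using w_nbr[OF that UV UX(2)] i(1) that(1) by blast
    \<comment> \<open>One particle is already missing and the swap removes another for a moment,
      hence \<open>2 \<le> d\<close>.\<close>
    have 3: "?m + 1 \<le> real (card U)" using UX(1) d by linarith
    show "reach ?m U U1" "card U1 = card U"
      unfolding U1_def using reach_swap[OF U_indep i(2) 1 wU(1) 2 3] by blast+
  qed
  have U1X: "U1 \<in> indep" by (rule reach_indep[OF r1(1) U_indep])
  have U1_reach: "reach ?m S U1" by (rule rtranclp_trans[OF U_reach r1(1)])
  have U1_Wh: "U1 \<inter> Wh = (U \<inter> Wh) - {a (Suc i)}" using w[of i] part by (auto simp: U1_def)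
  have a0: "a 0 \<notin> U1" using UX(3) w[of i] a[of 0] part by (auto simp: U1_def)
  have "U1 \<inter> range a = {}"
  proof (rule ccontr)
    assume "U1 \<inter> range a \<noteq> {}"
    moreover have "U1 \<inter> Wh \<subseteq> T \<inter> Wh" using U1_Wh UX(2) by blast
    ultimately have "Q U1" unfolding Q_def using U1_reach r1(2) UX(1) a0 by auto
    then have "card (U \<inter> Wh) \<le> card (U1 \<inter> Wh)" by (rule U_min)
    moreover have "a (Suc i) \<in> U \<inter> Wh" using i(2) a[of "Suc i"] by simp
    ultimately show False
      using card_Diff1_less[of "U \<inter> Wh" "a (Suc i)"] finU unfolding U1_Wh by (metis finite_Int leD)
  qed
  have U1V: "U1 \<subseteq> V" using U1X unfolding indep_def by blast
  have U1T: "U1 \<inter> Wh \<subseteq> T \<inter> Wh" using U1_Wh UX(2) by blast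
  \<comment> \<open>Both line neighbours of \<open>w (Suc i)\<close> are gone. Inserting it restores
    the particle number with fewer white particles than \<open>T\<close>, against
    \<open>min\<close>.\<close>
  have "\<not> adj (w (Suc i)) z" if "z \<in> U1" for z
    using w_nbr[OF that _ U1V U1T] that \<open>U1 \<inter> range a = {}\<close> by blast
  moreover have "w (Suc i) \<notin> U1" using wU(2) w_neq[of i] by (auto simp: U1_def)
  moreover have "w (Suc i) \<in> V" using w part by blast
  ultimately have r2: "reach ?m U1 (insert (w (Suc i)) U1)" "card (insert (w (Suc i)) U1) = card S"
    using reach_insert[OF U1X, of "w (Suc i)" ?m] r1(2) UX(1) d indep_finite[OF U1X] by auto
  have "insert (w (Suc i)) U1 \<in> plateau d S"
    by (rule plateauI[OF rtranclp_trans[OF U1_reach r2(1)] r2(2)])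
  moreover have "insert (w (Suc i)) U1 \<inter> Wh \<subset> T \<inter> Wh"
  proof -
    have "insert (w (Suc i)) U1 \<inter> Wh = U1 \<inter> Wh" using w[of "Suc i"] part by auto
    then show ?thesis using U1T a0 a[of 0] by blast
  qed
  ultimately show False using min by blast
qed

text \<open>Iterate the escapes. Each one that does not end at \<open>Wh\<close> or
  \<open>Bl\<close> gains a particle, and a gain only raises the level that later paths
  respect.\<close>

lemma reach_ground:
  assumes esc: "\<And>S. \<not> trapped d S" and S: "S \<in> indep"
  shows "\<exists>a\<in>{Wh, Bl}. reach (real (card S) - real d) S a"
  using S
proof (induction "card V - card S" arbitrary: S rule: less_induct)
  case less
  obtain T where T: "reach (real (card S) - real d) S T" "card S < card T \<or> T \<in> {Wh, Bl}"
    using esc[of S] less.prems unfolding trapped_def by (auto simp: not_le)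
  show ?case
  proof (cases "T \<in> {Wh, Bl}")
    case False
    then have c: "card S < card T" using T by simp
    have TX: "T \<in> indep" by (rule reach_indep[OF T(1) less.prems])
    then have "card T \<le> card V" using finite_V by (auto simp: indep_def intro: card_mono)
    then obtain a where "a \<in> {Wh, Bl}" "reach (real (card T) - real d) T a"
      using less.hyps[OF _ TX] c by (metis diff_less_mono2 less_le_trans)
    moreover from this(2) have "reach (real (card S) - real d) T a"
      by (rule reach_weaken) (use c in simp)
    ultimately show ?thesis using T(1) by (meson rtranclp_trans)
  qed (use T in blast)
qed

lemma reach_Bl_stays:
  assumes deg: "\<And>v. v \<in> Wh \<Longrightarrow> d < card {w \<in> Bl. adj v w}"
    and T: "reach (real (card Bl) - real d) Bl T"
  shows "T \<subseteq> Bl"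
  using T
proof (induction rule: rtranclp_induct)
  case (step T T')
  from step(2) have flip: "flip T T'" and T: "T \<in> indep" "T' \<in> indep" and c: "card Bl \<le> card T + d"
    by (auto simp: level_step_def)
  from flip show ?case
  proof (cases rule: flipE)
    case (1 v)
    have "v \<in> Bl"
    proof (rule ccontr)
      assume "v \<notin> Bl"
      then have v: "v \<in> Wh" using T 1 by (auto simp: indep_def Wh_def Bl_def)
      have finB: "finite Bl" using finite_V by (simp add: Bl_def)
      have "{w \<in> Bl. adj v w} \<subseteq> Bl - T" using T 1 by (auto simp: indep_def)
      then have "card {w \<in> Bl. adj v w} \<le> card (Bl - T)" using finB by (intro card_mono) auto
      also have "\<dots> = card Bl - card T"
        using step.IH finB finite_subset by (intro card_Diff_subset) auto
      finally show False using deg[OF v] c by linarith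
    qed
    then show ?thesis using step.IH 1 by simp
  qed (use step.IH in auto)
qed simp

end

section \<open>Mutually stuck sets in the plane\<close>

text \<open>The integer plane covers all three grids; \<open>I\<close> and \<open>J\<close> are the
  coordinate ranges, all integers in a periodic direction. Their convexity keeps points between
  members of \<open>A\<close> and \<open>B\<close> inside the grid.\<close>

locale stuck_pair =
  fixes A B :: "int \<Rightarrow> int \<Rightarrow> bool" and I J :: "int \<Rightarrow> bool"
  assumes I_convex: "I i \<Longrightarrow> I k \<Longrightarrow> i \<le> l \<Longrightarrow> l \<le> k \<Longrightarrow> I l"
    and J_convex: "J i \<Longrightarrow> J k \<Longrightarrow> i \<le> l \<Longrightarrow> l \<le> k \<Longrightarrow> J l"
    and A_box: "A i j \<Longrightarrow> I i \<and> J j" and B_box: "B i j \<Longrightarrow> I i \<and> J j"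
    and A_even: "A i j \<Longrightarrow> even (i + j)" and B_odd: "B i j \<Longrightarrow> odd (i + j)"
    and A_stuck: "A i j \<Longrightarrow> I k \<Longrightarrow> J l \<Longrightarrow> \<bar>k - i\<bar> + \<bar>l - j\<bar> = 1 \<Longrightarrow>
      \<exists>i' j'. A i' j' \<and> (i', j') \<noteq> (i, j) \<and> \<bar>k - i'\<bar> + \<bar>l - j'\<bar> = 1"
    and B_stuck: "B i j \<Longrightarrow> I k \<Longrightarrow> J l \<Longrightarrow> \<bar>k - i\<bar> + \<bar>l - j\<bar> = 1 \<Longrightarrow>
      \<exists>i' j'. B i' j' \<and> (i', j') \<noteq> (i, j) \<and> \<bar>k - i'\<bar> + \<bar>l - j'\<bar> = 1"
    and not_adjacent: "A i j \<Longrightarrow> B k l \<Longrightarrow> \<bar>k - i\<bar> + \<bar>l - j\<bar> \<noteq> 1"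
    and A_nonempty: "\<exists>i j. A i j" and B_nonempty: "\<exists>i j. B i j"
begin

lemma unit_neighbours:
  assumes "\<bar>k - i'\<bar> + \<bar>l - j'\<bar> = (1::int)" "s = 1 \<or> s = - 1" "t = 1 \<or> t = - 1"
  shows "(i', j') \<in> {(k + s, l), (k - s, l), (k, l + t), (k, l - t)}"
  using assms by auto

lemma I_between: "I i \<Longrightarrow> I k \<Longrightarrow> i \<le> l \<and> l \<le> k \<or> k \<le> l \<and> l \<le> i \<Longrightarrow> I l"
  using I_convex by blast

lemma J_between: "J i \<Longrightarrow> J k \<Longrightarrow> i \<le> l \<and> l \<le> k \<or> k \<le> l \<and> l \<le> i \<Longrightarrow> J l"
  using J_convex by blast

text \<open>
  If \<open>b = a + (s p, t q)\<close> is a closest pair with \<open>p \<ge> 2\<close> and \<open>q \<ge> 1\<close>, the second neighbour in \<open>A\<close> of the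
  point \<open>a + (s, 0)\<close> can only be \<open>a + (s, - t)\<close>, since the other two are closer to \<open>b\<close>; then
  \<open>b + (s, - t)\<close> is in \<open>B\<close> in the same way, and the displacement is unchanged.
\<close>
lemma exists_diagonal:
  obtains i j s t where "s = 1 \<or> s = - 1" "t = 1 \<or> t = - 1"
    "\<And>n. A (i + s * int n) (j + t * int n)"
    "\<And>n. I (i + s * (int n + 1)) \<and> J (j + t * int n)"
    "\<And>n. \<not> A (i + s * (int n + 2)) (j + t * int n)"
    "\<And>n. \<not> A (i + s * (int n + 1)) (j + t * (int n - 1))"
proof -
  define dist where "dist x = (case x of (i, j, k, l) \<Rightarrow> nat (\<bar>k - i\<bar> + \<bar>l - j\<bar>))"
    for x :: "int \<times> int \<times> int \<times> int"
  define pairs where "pairs x = (case x of (i, j, k, l) \<Rightarrow> A i j \<and> B k l)" for x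
  obtain x0 where "pairs x0" using A_nonempty B_nonempty by (auto simp: pairs_def)
  then obtain x where x: "pairs x" "\<And>y. pairs y \<Longrightarrow> dist x \<le> dist y"
    using ex_has_least_nat[of pairs x0 dist] by blast
  obtain i0 j0 k0 l0 where x_eq: "x = (i0, j0, k0, l0)" by (cases x) auto
  define D where "D = \<bar>k0 - i0\<bar> + \<bar>l0 - j0\<bar>"
  have a0: "A i0 j0" and b0: "B k0 l0" using x(1) by (auto simp: pairs_def x_eq)
  have D_min: "D \<le> \<bar>k - i\<bar> + \<bar>l - j\<bar>" if "A i j" "B k l" for i j k l
  proof -
    have "nat D \<le> nat (\<bar>k - i\<bar> + \<bar>l - j\<bar>)"
      using x(2)[of "(i, j, k, l)"] that by (simp add: pairs_def dist_def x_eq D_def)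
    then show ?thesis by linarith
  qed
  have step: "A (i + s) (j - t) \<and> B (i + s * p + s) (j + t * q - t) \<and> I (i + s) \<and> J j \<and>
      \<not> A (i + 2 * s) j \<and> \<not> A (i + s) (j + t)"
    if a: "A i j" and b: "B (i + s * p) (j + t * q)" and s: "s = 1 \<or> s = - 1"
      and t: "t = 1 \<or> t = - 1" and pq: "2 \<le> p" "1 \<le> q" "p + q = D" for i j s t p q
  proof -
    have Ii: "I i" "J j" and Ib: "I (i + s * p)" "J (j + t * q)" using A_box[OF a] B_box[OF b] by auto
    have Iw: "I (i + s)" by (rule I_between[OF Ii(1) Ib(1)]) (use s pq in auto)
    have Jw: "J (j + t * q - t)" by (rule J_between[OF Ii(2) Ib(2)]) (use t pq in auto)
    have n1: "\<not> A (i + 2 * s) j"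
      using D_min[OF _ b, of "i + 2 * s" j] s t pq by auto
    have n2: "\<not> A (i + s) (j + t)"
      using D_min[OF _ b, of "i + s" "j + t"] s t pq by auto
    obtain i' j' where a': "A i' j'" "(i', j') \<noteq> (i, j)" "\<bar>i + s - i'\<bar> + \<bar>j - j'\<bar> = 1"
      using A_stuck[OF a Iw Ii(2)] s by auto
    have a1: "A (i + s) (j - t)"
      using unit_neighbours[OF a'(3) s t] a'(1,2) n1 n2 by (auto simp: algebra_simps)
    have m1: "\<not> B (i + s * p) (j + t * q - t - t)"
      using D_min[OF a1, of "i + s * p" "j + t * q - t - t"] s t pq by auto
    have m2: "\<not> B (i + s * p - s) (j + t * q - t)"
      using D_min[OF a1, of "i + s * p - s" "j + t * q - t"] s t pq by auto
    obtain k' l' where b': "B k' l'" "(k', l') \<noteq> (i + s * p, j + t * q)"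
        "\<bar>i + s * p - k'\<bar> + \<bar>j + t * q - t - l'\<bar> = 1"
      using B_stuck[OF b Ib(1) Jw] t by auto
    have "B (i + s * p + s) (j + t * q - t)"
      using unit_neighbours[OF b'(3) s t] b'(1,2) m1 m2 by auto
    then show ?thesis using a1 Iw Ii(2) n1 n2 by blast
  qed
  \<comment> \<open>If only the second component of the displacement is at least 2, moving
    \<open>a\<close> alone trades one unit of it for a unit of the first, which leads back to
    \<open>step\<close>.\<close>
  have turn: "A (i - s) (j + t)"
    if a: "A i j" and b: "B (i + s * p) (j + t * q)" and s: "s = 1 \<or> s = - 1"
      and t: "t = 1 \<or> t = - 1" and pq: "1 \<le> p" "2 \<le> q" "p + q = D" for i j s t p q
  proof -
    have Ii: "I i" "J j" and Ib: "J (j + t * q)" using A_box[OF a] B_box[OF b] by auto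
    have Jw: "J (j + t)" by (rule J_between[OF Ii(2) Ib]) (use t pq in auto)
    have n1: "\<not> A i (j + 2 * t)"
      using D_min[OF _ b, of i "j + 2 * t"] s t pq by auto
    have n2: "\<not> A (i + s) (j + t)"
      using D_min[OF _ b, of "i + s" "j + t"] s t pq by auto
    obtain i' j' where a': "A i' j'" "(i', j') \<noteq> (i, j)" "\<bar>i - i'\<bar> + \<bar>j + t - j'\<bar> = 1"
      using A_stuck[OF a Ii(1) Jw] t by auto
    then show ?thesis
      using unit_neighbours[OF a'(3) s t] a'(1,2) n1 n2 by (auto simp: algebra_simps)
  qed
  have D3: "3 \<le> D"
  proof -
    have "odd D" using A_even[OF a0] B_odd[OF b0] unfolding D_def by presburger
    moreover have "D \<noteq> 1" using not_adjacent[OF a0 b0] by (simp add: D_def)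
    moreover have "0 \<le> D" by (simp add: D_def)
    ultimately show ?thesis by presburger
  qed
  define P where "P i j s t p q \<longleftrightarrow> A i j \<and> B (i + s * p) (j + t * q) \<and> (s = 1 \<or> s = - 1) \<and>
    (t = 1 \<or> t = - 1) \<and> p + q = D" for i j s t p q
  have turn': "\<exists>i j s t p q. P i j s t p q \<and> 2 \<le> p \<and> 1 \<le> q"
    if "P i j s t p q" "1 \<le> p" "2 \<le> q" for i j s t p q
  proof -
    have "A (i - s) (j + t)" using turn that unfolding P_def by blast
    then have "P (i - s) (j + t) s t (p + 1) (q - 1)"
      using that unfolding P_def by (auto simp: algebra_simps)
    then show ?thesis using that by (intro exI[of _ "i - s"] exI[of _ "j + t"] exI[of _ s]
      exI[of _ t] exI[of _ "p + 1"] exI[of _ "q - 1"]) auto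
  qed
  have sign: "\<exists>s p. (s = 1 \<or> s = - 1) \<and> 0 \<le> p \<and> k = i + s * p \<and> p = \<bar>k - i\<bar>" for i k :: int
  proof (cases "i \<le> k")
    case True
    then show ?thesis by (intro exI[of _ 1] exI[of _ "k - i"]) auto
  next
    case False
    then show ?thesis by (intro exI[of _ "- 1"] exI[of _ "i - k"]) auto
  qed
  obtain s0 p0 where s0: "s0 = 1 \<or> s0 = - 1" "0 \<le> p0" "k0 = i0 + s0 * p0" "p0 = \<bar>k0 - i0\<bar>"
    using sign by blast
  obtain t0 q0 where t0: "t0 = 1 \<or> t0 = - 1" "0 \<le> q0" "l0 = j0 + t0 * q0" "q0 = \<bar>l0 - j0\<bar>"
    using sign by blast
  have pqD: "p0 + q0 = D" using s0(4) t0(4) by (simp only: D_def)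
  have P0: "P i0 j0 s0 t0 p0 q0"
    unfolding P_def s0(3)[symmetric] t0(3)[symmetric] using a0 b0 s0(1) t0(1) pqD by blast
  have "\<exists>i j s t p q. P i j s t p q \<and> 2 \<le> p \<and> 1 \<le> q"
  proof -
    consider "2 \<le> p0" "1 \<le> q0" | "1 \<le> p0" "2 \<le> q0" | "q0 = 0" "3 \<le> p0" | "p0 = 0" "3 \<le> q0"
      using pqD D3 s0(2) t0(2) by linarith
    then show ?thesis
    proof cases
      case 1
      then show ?thesis using P0 by blast
    next
      case 2
      then show ?thesis using turn' P0 by blast
    next
      \<comment> \<open>Both points have the same second coordinate. The second neighbour in
        \<open>A\<close> must leave that line, to either side, which makes both components of the
        displacement nonzero; the last case is analogous.\<close>
      case 3
      have b: "B (i0 + s0 * p0) j0" using b0 s0(3) t0(3) 3(1) by simp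
      have w: "I (i0 + s0)"
        by (rule I_between[of i0 "i0 + s0 * p0"]) (use A_box[OF a0] B_box[OF b] s0(1) 3 in auto)
      have n: "\<not> A (i0 + 2 * s0) j0"
        using D_min[OF _ b, of "i0 + 2 * s0" j0] s0(1) 3 pqD by auto
      obtain i' j' where a': "A i' j'" "(i', j') \<noteq> (i0, j0)" "\<bar>i0 + s0 - i'\<bar> + \<bar>j0 - j'\<bar> = 1"
        using A_stuck[OF a0 w, of j0] A_box[OF a0] s0(1) by auto
      have "A (i0 + s0) (j0 + 1) \<or> A (i0 + s0) (j0 - 1)"
        using unit_neighbours[OF a'(3) s0(1), of 1] a'(1,2) n by (auto simp: algebra_simps)
      then obtain t where t: "t = 1 \<or> t = - 1" "A (i0 + s0) (j0 + t)" by force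
      have "P (i0 + s0) (j0 + t) s0 (- t) (p0 - 1) 1"
      proof -
        have eq: "i0 + s0 + s0 * (p0 - 1) = i0 + s0 * p0" "j0 + t + - t * 1 = j0"
          by (simp_all add: algebra_simps)
        have "- t = 1 \<or> - t = - 1" "p0 - 1 + 1 = D" using t(1) 3(1) pqD by auto
        then show ?thesis unfolding P_def eq using t(2) b s0(1) by blast
      qed
      moreover have "2 \<le> p0 - 1" using 3(2) by simp
      ultimately show ?thesis by (meson order_refl)
    next
      case 4
      have b: "B i0 (j0 + t0 * q0)" using b0 s0(3) t0(3) 4(1) by simp
      have w: "J (j0 + t0)"
        by (rule J_between[of j0 "j0 + t0 * q0"]) (use A_box[OF a0] B_box[OF b] t0(1) 4 in auto)
      have n: "\<not> A i0 (j0 + 2 * t0)"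
        using D_min[OF _ b, of i0 "j0 + 2 * t0"] t0(1) 4 pqD by auto
      obtain i' j' where a': "A i' j'" "(i', j') \<noteq> (i0, j0)" "\<bar>i0 - i'\<bar> + \<bar>j0 + t0 - j'\<bar> = 1"
        using A_stuck[OF a0 _ w, of i0] A_box[OF a0] t0(1) by auto
      have "A (i0 + 1) (j0 + t0) \<or> A (i0 - 1) (j0 + t0)"
        using unit_neighbours[OF a'(3) _ t0(1), of 1] a'(1,2) n by (auto simp: algebra_simps)
      then obtain s where s: "s = 1 \<or> s = - 1" "A (i0 + s) (j0 + t0)" by force
      have "P (i0 + s) (j0 + t0) (- s) t0 1 (q0 - 1)"
      proof -
        have eq: "i0 + s + - s * 1 = i0" "j0 + t0 + t0 * (q0 - 1) = j0 + t0 * q0"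
          by (simp_all add: algebra_simps)
        have "- s = 1 \<or> - s = - 1" "1 + (q0 - 1) = D" using s(1) 4(1) pqD by auto
        then show ?thesis unfolding P_def eq using s(2) b t0(1) by blast
      qed
      then show ?thesis using turn'[of "i0 + s" "j0 + t0" "- s" t0 1 "q0 - 1"] 4(2) by simp
    qed
  qed
  then obtain i j s t p q where P: "P i j s t p q" and pq: "2 \<le> p" "1 \<le> q" by blast
  note P' = P[unfolded P_def]
  have line: "A (i + s * int n) (j - t * int n) \<and>
      B (i + s * int n + s * p) (j - t * int n + t * q)" for n
  proof (induction n)
    case 0
    then show ?case using P' by simp
  next
    case (Suc n)
    then show ?case
      using step[of "i + s * int n" "j - t * int n" s p t q] P' pq by (simp add: algebra_simps)
  qed
  \<comment> \<open>The two excluded points are the other neighbours of the intermediate site, whose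
    neighbours in \<open>A\<close> are thus exactly two consecutive points of the line.\<close>
  have st: "I (i + s * int n + s) \<and> J (j - t * int n) \<and> \<not> A (i + s * int n + 2 * s) (j - t * int n) \<and>
      \<not> A (i + s * int n + s) (j - t * int n + t)" for n
    using step[of "i + s * int n" "j - t * int n" s p t q] line[of n] P' pq by blast
  show thesis
  proof (rule that[of s "- t" i j])
    show "s = 1 \<or> s = - 1" "- t = 1 \<or> - t = - 1" using P' by auto
    fix n
    show "A (i + s * int n) (j + - t * int n)" using line[of n] by simp
    show "I (i + s * (int n + 1)) \<and> J (j + - t * int n)"
      using st[of n] by (simp add: algebra_simps)
    show "\<not> A (i + s * (int n + 2)) (j + - t * int n)"
      using st[of n] by (simp add: algebra_simps)
    show "\<not> A (i + s * (int n + 1)) (j + - t * (int n - 1))"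
      using st[of n] by (simp add: algebra_simps)
  qed
qed

end

section \<open>Grid graphs\<close>

text \<open>
  A coordinate runs over a path or, if \<open>per\<close> holds, over a cycle; \<open>line_proj\<close> is the covering of the
  cycle by the integers. In the grids the first coordinate has period \<open>L\<close> and the second period \<open>K\<close>.
\<close>
definition line_adj :: "bool \<Rightarrow> nat \<Rightarrow> nat \<Rightarrow> nat \<Rightarrow> bool" where
  "line_adj per n a b \<longleftrightarrow> \<bar>int a - int b\<bar> = 1 \<or> per \<and> {a, b} = {0, n - 1}"

definition line_proj :: "bool \<Rightarrow> nat \<Rightarrow> int \<Rightarrow> nat" where
  "line_proj per n i = nat (if per then i mod int n else i)"

definition line_range :: "bool \<Rightarrow> nat \<Rightarrow> int \<Rightarrow> bool" where
  "line_range per n i \<longleftrightarrow> per \<or> 0 \<le> i \<and> i < int n"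

lemma line_adj_sym: "line_adj per n a b \<Longrightarrow> line_adj per n b a"
  by (auto simp: line_adj_def insert_commute abs_minus_commute)

lemma line_proj_less: "0 < n \<Longrightarrow> line_range per n i \<Longrightarrow> line_proj per n i < n"
  by (auto simp: line_proj_def line_range_def nat_less_iff)

lemma line_proj_of_nat: "b < n \<Longrightarrow> line_proj per n (int b) = b \<and> line_range per n (int b)"
  by (auto simp: line_proj_def line_range_def)

lemma line_proj_parity:
  assumes "0 < n" "per \<longrightarrow> even n" "line_range per n i"
  shows "even (line_proj per n i) \<longleftrightarrow> even i"
proof (cases per)
  case True
  have "even (i mod int n) \<longleftrightarrow> even i" using assms True by (simp add: dvd_mod_iff)
  then show ?thesis using assms True by (simp add: line_proj_def even_nat_iff)
next
  case False
  then show ?thesis using assms by (simp add: line_proj_def line_range_def even_nat_iff)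
qed

lemma line_adj_parity:
  assumes "2 \<le> n" "per \<longrightarrow> even n" "line_adj per n a b"
  shows "even a \<noteq> even b"
proof (cases "\<bar>int a - int b\<bar> = 1")
  case True
  then have "even (int a) \<noteq> even (int b)" by presburger
  then show ?thesis by simp
next
  case False
  then have "even n" "{a, b} = {0, n - 1}" using assms by (auto simp: line_adj_def)
  then show ?thesis using assms(1) by (auto simp: doubleton_eq_iff)
qed

lemma line_adj_Suc_mod: "2 \<le> n \<Longrightarrow> a < n \<Longrightarrow> line_adj True n a (Suc a mod n)"
  by (cases "Suc a = n") (auto simp: line_adj_def)

lemma line_proj_succ:
  "2 \<le> n \<Longrightarrow> line_proj True n (i + 1) = Suc (line_proj True n i) mod n"
proof -
  assume n: "2 \<le> n"
  have "int (Suc (line_proj True n i) mod n) = (i mod int n + 1) mod int n"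
    using n by (simp add: line_proj_def zmod_int add.commute)
  also have "\<dots> = (i + 1) mod int n" by (simp add: mod_simps)
  finally show ?thesis using n by (simp add: line_proj_def)
qed

lemma line_proj_adj:
  assumes "2 \<le> n" "line_range per n i" "line_range per n k" "\<bar>k - i\<bar> = 1"
  shows "line_adj per n (line_proj per n i) (line_proj per n k)"
proof (cases per)
  case True
  have up: "line_adj True n (line_proj True n i) (line_proj True n (i + 1))" for i
    using line_adj_Suc_mod[of n "line_proj True n i"] line_proj_succ[of n i] assms(1)
      line_proj_less[of n True i] by (simp add: line_range_def)
  from assms(4) have "k = i + 1 \<or> i = k + 1" by auto
  then show ?thesis using up[of i] up[of k] True line_adj_sym by auto
next
  case False
  then show ?thesis using assms by (auto simp: line_proj_def line_range_def line_adj_def)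
qed

text \<open>Edge lifting for the covering. For a periodic line with \<open>n = 2\<close> both
  \<open>i - 1\<close> and \<open>i + 1\<close> lie over the same neighbour, so the lift need not be
  unique.\<close>

lemma line_adj_lift:
  assumes "2 \<le> n" "line_range per n i" "b < n" "line_adj per n (line_proj per n i) b"
  shows "\<exists>k. \<bar>i - k\<bar> = 1 \<and> line_range per n k \<and> line_proj per n k = b"
proof (cases per)
  case True
  define a where "a = line_proj True n i"
  have an: "a < n" using assms True by (simp add: a_def line_proj_less line_range_def)
  have "b = Suc a mod n \<or> a = Suc b mod n"
  proof -
    have "\<bar>int a - int b\<bar> = 1 \<or> a = 0 \<and> b = n - 1 \<or> a = n - 1 \<and> b = 0"
      using assms(4) True by (auto simp: line_adj_def a_def doubleton_eq_iff)
    then have "b = Suc a \<or> a = Suc b \<or> a = 0 \<and> b = n - 1 \<or> a = n - 1 \<and> b = 0" by linarith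
    then show ?thesis using an assms(1,3) by auto
  qed
  then show ?thesis
  proof
    assume "b = Suc a mod n"
    then have "line_proj True n (i + 1) = b" using line_proj_succ assms(1) by (simp add: a_def)
    then show ?thesis using True by (intro exI[of _ "i + 1"]) (simp add: line_range_def)
  next
    assume a: "a = Suc b mod n"
    define c where "c = line_proj True n (i - 1)"
    have c: "c < n" using assms(1) by (simp add: c_def line_proj_less line_range_def)
    have "Suc c mod n = Suc b mod n"
      using line_proj_succ[of n "i - 1"] assms(1) a by (simp add: a_def c_def)
    then have "c = b" using c assms(3) by (auto simp: mod_Suc split: if_splits)
    then show ?thesis using True by (intro exI[of _ "i - 1"]) (simp add: c_def line_range_def)
  qed
next
  case False
  then have "\<bar>i - int b\<bar> = 1" using assms by (auto simp: line_adj_def line_proj_def line_range_def)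
  then show ?thesis using False assms(3) line_proj_of_nat by blast
qed

text \<open>For \<open>n = 2\<close> the wrap-around edge coincides with the ordinary one; a
  periodic line has degree 2 only from \<open>n = 3\<close> on.\<close>

lemma line_degree:
  assumes "2 \<le> n" "a < n"
  shows "1 \<le> card {b. b < n \<and> line_adj per n a b}"
    and "per \<Longrightarrow> 3 \<le> n \<Longrightarrow> 2 \<le> card {b. b < n \<and> line_adj per n a b}"
proof -
  let ?S = "{b. b < n \<and> line_adj per n a b}"
  have fin: "finite ?S" by simp
  have "(if a = 0 then 1 else a - 1) \<in> ?S" using assms by (auto simp: line_adj_def)
  then have "?S \<noteq> {}" by blast
  then show "1 \<le> card ?S" using fin by (simp add: Suc_le_eq card_gt_0_iff)
  assume per and n: "3 \<le> n"
  let ?p = "if a = 0 then n - 1 else a - 1" and ?q = "if a = n - 1 then 0 else a + 1"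
  have "{?p, ?q} \<subseteq> ?S" using \<open>per\<close> assms by (auto simp: line_adj_def)
  moreover have "?p \<noteq> ?q" using n by auto
  ultimately show "2 \<le> card ?S" using card_mono[OF fin, of "{?p, ?q}"] by simp
qed

section \<open>The three grids as products of paths and cycles\<close>

abbreviation x_per :: "grid_kind \<Rightarrow> bool" where "x_per g \<equiv> g = TorusGrid"
abbreviation y_per :: "grid_kind \<Rightarrow> bool" where "y_per g \<equiv> g \<noteq> OpenGrid"

lemma open_adj_iff:
  "open_adj v w \<longleftrightarrow> fst v = fst w \<and> \<bar>int (snd v) - int (snd w)\<bar> = 1 \<or>
     snd v = snd w \<and> \<bar>int (fst v) - int (fst w)\<bar> = 1"
proof -
  have "\<bar>a\<bar> + \<bar>b\<bar> = 1 \<longleftrightarrow> a = 0 \<and> \<bar>b\<bar> = 1 \<or> b = 0 \<and> \<bar>a\<bar> = 1" for a b :: int by linarith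
  then show ?thesis unfolding open_adj_def by simp
qed

lemma adj_iff_line:
  "adj g K L v w \<longleftrightarrow> fst v = fst w \<and> line_adj (y_per g) K (snd v) (snd w) \<or>
     snd v = snd w \<and> line_adj (x_per g) L (fst v) (fst w)"
proof -
  have cyl: "(a \<and> x \<or> b \<and> y) \<or> a \<and> z \<longleftrightarrow> a \<and> (x \<or> True \<and> z) \<or> b \<and> (y \<or> False \<and> z')"
    and tor: "(a \<and> x \<or> b \<and> y) \<or> a \<and> z \<or> b \<and> z' \<longleftrightarrow> a \<and> (x \<or> True \<and> z) \<or> b \<and> (y \<or> True \<and> z')"
    for a b x y z z' by blast+
  show ?thesis
    using cyl tor
    by (cases g; simp only: adj.simps open_adj_iff cyl_edge_def tor_edge_def line_adj_def
        grid_kind.distinct simp_thms)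
qed

lemma valid_gridD:
  assumes "valid_grid g K L"
  shows "2 \<le> K" "2 \<le> L" "y_per g \<longrightarrow> even K" "x_per g \<longrightarrow> even L"
  using assms by (cases g; simp)+

lemma sites_eq: "sites K L = {..<L} \<times> {..<K}"
  by (auto simp: sites_def)

definition even_site :: "nat \<times> nat \<Rightarrow> bool" where
  "even_site v \<longleftrightarrow> even (fst v + snd v)"

locale grid =
  fixes g :: grid_kind and K L :: nat
  assumes valid: "valid_grid g K L"
begin

lemmas dims = valid_gridD[OF valid]

sublocale bipartite_graph "sites K L" even_site "adj g K L"
proof
  show "finite (sites K L)" by (simp add: sites_eq)
  show "adj g K L w v" if "adj g K L v w" for v w
    using that line_adj_sym by (auto simp: adj_iff_line)
  show "even_site v \<noteq> even_site w" if "adj g K L v w" for v w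
    using that line_adj_parity[OF dims(1,3)] line_adj_parity[OF dims(2,4)]
    by (auto simp: adj_iff_line even_site_def)
qed

lemma Wh_eq: "Wh = conf_e K L" and Bl_eq: "Bl = conf_o K L" and indep_eq: "indep = hc_states g K L"
  by (auto simp: Wh_def Bl_def indep_def conf_e_def conf_o_def hc_states_def even_site_def)

definition point :: "int \<Rightarrow> int \<Rightarrow> nat \<times> nat" where
  "point i j = (line_proj (x_per g) L i, line_proj (y_per g) K j)"

abbreviation x_range :: "int \<Rightarrow> bool" where "x_range \<equiv> line_range (x_per g) L"
abbreviation y_range :: "int \<Rightarrow> bool" where "y_range \<equiv> line_range (y_per g) K"

lemma point_in_sites: "x_range i \<Longrightarrow> y_range j \<Longrightarrow> point i j \<in> sites K L"
  using dims by (auto simp: point_def sites_def line_proj_less)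

lemma point_surj: "v \<in> sites K L \<Longrightarrow> \<exists>i j. x_range i \<and> y_range j \<and> point i j = v"
  using line_proj_of_nat[of "fst v" L "x_per g"] line_proj_of_nat[of "snd v" K "y_per g"]
  by (intro exI[of _ "int (fst v)"] exI[of _ "int (snd v)"]) (auto simp: sites_def point_def)

lemma point_parity: "x_range i \<Longrightarrow> y_range j \<Longrightarrow>
    even_site (point i j) \<longleftrightarrow> even (i + j)"
  using dims line_proj_parity[of L "x_per g" i] line_proj_parity[of K "y_per g" j]
  by (simp add: point_def even_site_def)

lemma point_adj:
  assumes "x_range i" "y_range j" "x_range k" "y_range l" "\<bar>k - i\<bar> + \<bar>l - j\<bar> = 1"
  shows "adj g K L (point i j) (point k l)"
proof -
  have "i = k \<and> \<bar>l - j\<bar> = 1 \<or> j = l \<and> \<bar>k - i\<bar> = 1" using assms(5) by auto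
  then show ?thesis
    using line_proj_adj[OF dims(1) assms(2,4)] line_proj_adj[OF dims(2) assms(1,3)]
    by (auto simp: adj_iff_line point_def)
qed

lemma adj_lift:
  assumes "x_range k" "y_range l" "v \<in> sites K L" "adj g K L (point k l) v"
  shows "\<exists>i j. x_range i \<and> y_range j \<and> point i j = v \<and> \<bar>k - i\<bar> + \<bar>l - j\<bar> = 1"
proof -
  have v: "fst v < L" "snd v < K" using assms(3) by (auto simp: sites_def)
  from assms(4) consider
    "line_proj (x_per g) L k = fst v" "line_adj (y_per g) K (line_proj (y_per g) K l) (snd v)" |
    "line_proj (y_per g) K l = snd v" "line_adj (x_per g) L (line_proj (x_per g) L k) (fst v)"
    by (auto simp: adj_iff_line point_def)
  then show ?thesis
  proof cases
    case 1
    then obtain j where "\<bar>l - j\<bar> = 1" "y_range j" "line_proj (y_per g) K j = snd v"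
      using line_adj_lift[OF dims(1) assms(2) v(2)] by blast
    then show ?thesis using 1 assms(1) by (intro exI[of _ k] exI[of _ j]) (simp add: point_def)
  next
    case 2
    then obtain i where "\<bar>k - i\<bar> = 1" "x_range i" "line_proj (x_per g) L i = fst v"
      using line_adj_lift[OF dims(2) assms(1) v(1)] by blast
    then show ?thesis using 2 assms(2) by (intro exI[of _ i] exI[of _ l]) (simp add: point_def)
  qed
qed

text \<open>
  Depth 1 does not suffice on the torus: if \<open>K\<close> and \<open>L\<close> have a common divisor that is at least 6,
  alternating diagonal stripes of both parities form a well of depth 2.
\<close>
definition depth :: nat where
  "depth = (if g = TorusGrid \<and> (2 < K \<or> 2 < L) then 2 else 1)"

text \<open>A torus with exactly one side of length 2 has degree 3, just enough for depth 2. With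
  both sides 2 it is a 4-cycle of degree 2, which is why \<open>depth\<close> falls back to 1
  there.\<close>

lemma degree:
  assumes "v \<in> sites K L"
  shows "depth < card {w \<in> sites K L. adj g K L v w}"
proof -
  obtain x y where v: "v = (x, y)" "x < L" "y < K" using assms by (auto simp: sites_def)
  define Y where "Y = {b. b < K \<and> line_adj (y_per g) K y b}"
  define Z where "Z = {b. b < L \<and> line_adj (x_per g) L x b}"
  have fin: "finite Y" "finite Z" by (auto simp: Y_def Z_def)
  have irr: "y \<notin> Y" "x \<notin> Z"
    using line_adj_parity[OF dims(1,3)] line_adj_parity[OF dims(2,4)] by (auto simp: Y_def Z_def)
  have "Pair x ` Y \<union> (\<lambda>a. (a, y)) ` Z \<subseteq> {w \<in> sites K L. adj g K L v w}"
    using v by (auto simp: sites_def adj_iff_line Y_def Z_def)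
  moreover have "finite {w \<in> sites K L. adj g K L v w}" using finite_V by simp
  ultimately have "card (Pair x ` Y \<union> (\<lambda>a. (a, y)) ` Z) \<le> card {w \<in> sites K L. adj g K L v w}"
    by (rule card_mono[rotated])
  moreover have "card (Pair x ` Y \<union> (\<lambda>a. (a, y)) ` Z) = card Y + card Z"
    using fin irr by (subst card_Un_disjoint) (auto simp: card_image inj_on_def)
  moreover have "1 \<le> card Y" "1 \<le> card Z"
    unfolding Y_def Z_def using line_degree(1) dims v by auto
  moreover have "2 \<le> card Y" if "g = TorusGrid" "2 < K"
    unfolding Y_def using line_degree(2)[of K y "y_per g"] that v by auto
  moreover have "2 \<le> card Z" if "g = TorusGrid" "2 < L"
    unfolding Z_def using line_degree(2)[of L x "x_per g"] that v by auto
  ultimately show ?thesis unfolding depth_def by (auto split: if_splits)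
qed

lemma not_trapped: "\<not> trapped depth S"
proof
  assume S: "trapped depth S"
  have d: "1 \<le> depth" by (simp add: depth_def)
  obtain A B T where T: "T \<in> plateau depth S" and A: "A = T \<inter> Wh" and B: "B \<subseteq> Bl"
    and ne: "A \<noteq> {}" "B \<noteq> {}" and ind: "A \<union> B \<in> indep"
    and min: "\<And>T'. T' \<in> plateau depth S \<Longrightarrow> \<not> T' \<inter> Wh \<subset> A"
    and stA: "\<And>w v. w \<in> Bl \<Longrightarrow> {z \<in> A. adj g K L w z} \<noteq> {v}"
    and stB: "\<And>w v. w \<in> Wh \<Longrightarrow> {z \<in> B. adj g K L w z} \<noteq> {v}"
    by (rule trapped_core[OF S d]) blast
  have A_sites: "A \<subseteq> sites K L" and B_sites: "B \<subseteq> sites K L"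
    using A B by (auto simp: Wh_def Bl_def)
  have A_Wh: "A \<subseteq> Wh" using A by simp
  define LA where "LA i j \<longleftrightarrow> x_range i \<and> y_range j \<and> point i j \<in> A" for i j
  define LB where "LB i j \<longleftrightarrow> x_range i \<and> y_range j \<and> point i j \<in> B" for i j
  \<comment> \<open>A second neighbour in the grid lifts to a neighbour of \<open>(k, l)\<close>; it
    differs from \<open>(i, j)\<close> because the projections differ.\<close>
  have lift_stuck: "\<exists>i' j'. (x_range i' \<and> y_range j' \<and> point i' j' \<in> C) \<and> (i', j') \<noteq> (i, j) \<and>
      \<bar>k - i'\<bar> + \<bar>l - j'\<bar> = 1"
    if ij: "x_range i" "y_range j" "point i j \<in> C" and kl: "x_range k" "y_range l"
      and near: "\<bar>k - i\<bar> + \<bar>l - j\<bar> = 1" and C: "C \<subseteq> sites K L"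
      and st: "{z \<in> C. adj g K L (point k l) z} \<noteq> {point i j}" for C i j k l
  proof -
    have "adj g K L (point k l) (point i j)"
      by (rule point_adj) (use ij kl near in auto)
    then obtain z where z: "z \<in> C" "adj g K L (point k l) z" "z \<noteq> point i j"
      using st ij(3) by blast
    then obtain i' j' where "x_range i'" "y_range j'" "point i' j' = z" "\<bar>k - i'\<bar> + \<bar>l - j'\<bar> = 1"
      using adj_lift[OF kl, of z] C by blast
    then show ?thesis using z by blast
  qed
  interpret stuck_pair LA LB x_range y_range
  proof
    show "x_range l" if "x_range i" "x_range k" "i \<le> l" "l \<le> k" for i k l
      using that by (auto simp: line_range_def)
    show "y_range l" if "y_range i" "y_range k" "i \<le> l" "l \<le> k" for i k l
      using that by (auto simp: line_range_def)
    show "x_range i \<and> y_range j" if "LA i j" for i j using that by (simp add: LA_def)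
    show "x_range i \<and> y_range j" if "LB i j" for i j using that by (simp add: LB_def)
    show even: "even (i + j)" if "LA i j" for i j
      using that point_parity[of i j] A_Wh by (auto simp: LA_def Wh_def)
    show odd: "odd (i + j)" if "LB i j" for i j
      using that point_parity[of i j] B by (auto simp: LB_def Bl_def)
    show "\<exists>i' j'. LA i' j' \<and> (i', j') \<noteq> (i, j) \<and> \<bar>k - i'\<bar> + \<bar>l - j'\<bar> = 1"
      if "LA i j" "x_range k" "y_range l" "\<bar>k - i\<bar> + \<bar>l - j\<bar> = 1" for i j k l
    proof -
      have "odd (k + l)" using even[OF that(1)] that(4) by presburger
      then have "point k l \<in> Bl"
        using point_parity[OF that(2,3)] point_in_sites[OF that(2,3)] by (simp add: Bl_def)
      from stA[OF this] show ?thesis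
        using lift_stuck[of i j A k l] that A_sites unfolding LA_def by blast
    qed
    show "\<exists>i' j'. LB i' j' \<and> (i', j') \<noteq> (i, j) \<and> \<bar>k - i'\<bar> + \<bar>l - j'\<bar> = 1"
      if "LB i j" "x_range k" "y_range l" "\<bar>k - i\<bar> + \<bar>l - j\<bar> = 1" for i j k l
    proof -
      have "even (k + l)" using odd[OF that(1)] that(4) by presburger
      then have "point k l \<in> Wh"
        using point_parity[OF that(2,3)] point_in_sites[OF that(2,3)] by (simp add: Wh_def)
      from stB[OF this] show ?thesis
        using lift_stuck[of i j B k l] that B_sites unfolding LB_def by blast
    qed
    show "\<bar>k - i\<bar> + \<bar>l - j\<bar> \<noteq> 1" if "LA i j" "LB k l" for i j k l
      using point_adj[of i j k l] that ind unfolding LA_def LB_def indep_def by blast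
    show "\<exists>i j. LA i j" using ne(1) A_sites point_surj unfolding LA_def by blast
    show "\<exists>i j. LB i j" using ne(2) B_sites point_surj unfolding LB_def by blast
  qed
  obtain i j s t where s: "s = 1 \<or> s = - 1" and t: "t = 1 \<or> t = - 1"
    and line: "\<And>n. LA (i + s * int n) (j + t * int n)"
    and range: "\<And>n. x_range (i + s * (int n + 1)) \<and> y_range (j + t * int n)"
    and not1: "\<And>n. \<not> LA (i + s * (int n + 2)) (j + t * int n)"
    and not2: "\<And>n. \<not> LA (i + s * (int n + 1)) (j + t * (int n - 1))"
    by (rule exists_diagonal) blast
  show False
  proof (cases "g = TorusGrid")
    case False
    \<comment> \<open>Outside the torus the first coordinate is bounded, while the diagonal changes
      it by 1 at each step; this index is beyond either end.\<close>
    have "0 \<le> i + s * (int (nat \<bar>i\<bar> + L) + 1)" "i + s * (int (nat \<bar>i\<bar> + L) + 1) < int L"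
      using range[of "nat \<bar>i\<bar> + L"] False by (auto simp: line_range_def)
    then show False using s by auto
  next
    case True
    show False
    proof (cases "2 < K \<or> 2 < L")
      case False
      \<comment> \<open>In the 4-cycle every even site touches every odd one, so \<open>A\<close>
        and \<open>B\<close> cannot avoid contact.\<close>
      then have KL: "K = 2" "L = 2" using dims by auto
      obtain v w where vw: "v \<in> A" "w \<in> B" using ne by blast
      then have "v \<in> sites K L" "w \<in> sites K L" "even_site v" "\<not> even_site w"
        using A_Wh B unfolding Wh_def Bl_def by blast+
      then have "fst v < 2" "snd v < 2" "fst w < 2" "snd w < 2"
        and parity: "even (fst v + snd v)" "odd (fst w + snd w)"
        using KL unfolding sites_def even_site_def by auto
      then have "fst v \<in> {0, 1}" "snd v \<in> {0, 1}" "fst w \<in> {0, 1}" "snd w \<in> {0, 1}"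
        using less_2_cases by auto
      then have "open_adj v w" using parity unfolding open_adj_def by (elim insertE emptyE; simp)
      then have "adj g K L v w" using True by simp
      then show False using vw ind unfolding indep_def by blast
    next
      case big: True
      define a where "a n = point (i + s * int n) (j + t * int n)" for n
      define w where "w n = point (i + s * (int n + 1)) (j + t * int n)" for n
      have aA: "a n \<in> A" for n using line[of n] by (simp add: LA_def a_def)
      have a_Suc: "a (Suc n) = point (i + s * (int n + 1)) (j + t * (int n + 1))" for n
        by (simp add: a_def algebra_simps)
      have aw: "adj g K L (w n) (a n)" "adj g K L (w n) (a (Suc n))" for n
      proof -
        show "adj g K L (w n) (a n)" unfolding w_def a_def
          by (rule point_adj) (use range[of n] line[of n] s in \<open>auto simp: LA_def algebra_simps\<close>)
        have "LA (i + s * (int n + 1)) (j + t * (int n + 1))"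
          using line[of "Suc n"] by (simp add: algebra_simps)
        then show "adj g K L (w n) (a (Suc n))" unfolding w_def a_Suc
          by (intro point_adj) (use range[of n] t in \<open>auto simp: LA_def algebra_simps\<close>)
      qed
      have wBl: "w n \<in> Bl" for n
      proof -
        have "w n \<in> sites K L" unfolding w_def by (rule point_in_sites) (use range[of n] in auto)
        then show ?thesis using adj_white[OF _ _ aw(1), of n] aA[of n] A_Wh by (auto simp: Wh_def Bl_def)
      qed
      have nbrs: "{z \<in> A. adj g K L (w n) z} = {a n, a (Suc n)}" for n
      proof (intro equalityI subsetI)
        fix z assume "z \<in> {z \<in> A. adj g K L (w n) z}"
        then have z: "z \<in> A" "adj g K L (w n) z" by auto
        obtain i' j' where ij': "x_range i'" "y_range j'" "point i' j' = z"
          "\<bar>i + s * (int n + 1) - i'\<bar> + \<bar>j + t * int n - j'\<bar> = 1"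
          using adj_lift[of "i + s * (int n + 1)" "j + t * int n" z] z range[of n] A_sites
          unfolding w_def by blast
        have LA': "LA i' j'" using ij' z by (simp add: LA_def)
        have e: "i + s * (int n + 1) + s = i + s * (int n + 2)"
          "i + s * (int n + 1) - s = i + s * int n"
          "j + t * int n + t = j + t * (int n + 1)" "j + t * int n - t = j + t * (int n - 1)"
          by (simp_all add: algebra_simps)
        have "(i', j') = (i + s * int n, j + t * int n) \<or>
            (i', j') = (i + s * (int n + 1), j + t * (int n + 1))"
          using unit_neighbours[OF ij'(4) s t] LA' not1[of n] not2[of n] unfolding e by blast
        then show "z \<in> {a n, a (Suc n)}"
          using ij'(3) unfolding a_Suc a_def[of n] by blast
      qed (use aA aw in auto)
      \<comment> \<open>The projection is not injective, but \<open>L\<close> is even, so parity of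
        the first coordinate still tells consecutive sites apart.\<close>
      have parity: "even (fst (point k l)) \<longleftrightarrow> even k" if "x_range k" for k l
        using line_proj_parity[OF _ dims(4) that] dims by (simp add: point_def)
      have xr: "x_range k" for k using True by (simp add: line_range_def)
      have "a n \<noteq> a (Suc n)" "w n \<noteq> w (Suc n)" for n
      proof -
        have "even (fst (a n)) \<noteq> even (fst (a (Suc n)))" "even (fst (w n)) \<noteq> even (fst (w (Suc n)))"
          unfolding a_def w_def parity[OF xr] using s by auto
        then show "a n \<noteq> a (Suc n)" "w n \<noteq> w (Suc n)" by auto
      qed
      moreover have "2 \<le> depth" using big True unfolding depth_def by simp
      ultimately show False
        using trapped_no_line[OF S _ T, of a w] min aA wBl nbrs unfolding A by blast
    qed
  qed
qed

end

section \<open>Sizes of independent sets\<close>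

text \<open>Independent sets of a path: each pair {2k, 2k + 1} contains at most one element. A
  missing even \<open>m\<close> cuts the path into pieces of lengths \<open>m\<close> and
  \<open>n - m - 1\<close>; the first splits exactly into pairs, which saves one element when
  \<open>n\<close> is odd.\<close>

lemma sparse_card:
  assumes P: "P \<subseteq> {..<n::nat}" and sparse: "\<And>k. k \<in> P \<Longrightarrow> Suc k \<notin> P"
  shows "card P \<le> Suc n div 2"
    and "even m \<Longrightarrow> m < n \<Longrightarrow> m \<notin> P \<Longrightarrow> card P \<le> n div 2"
proof -
  have half: "p = q \<or> q = Suc p \<or> p = Suc q" if "p div 2 = q div 2" for p q :: nat
    using that by presburger
  have eq: "p = q" if "p \<in> P" "q \<in> P" "p div 2 = q div 2" for p q
    using half[OF that(3)] sparse that by blast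
  then have "inj_on (\<lambda>p. p div 2) P" by (auto simp: inj_on_def)
  then have "card P = card ((\<lambda>p. p div 2) ` P)" by (simp add: card_image)
  also have "\<dots> \<le> card {..<Suc n div 2}" using P by (intro card_mono) force+
  finally show "card P \<le> Suc n div 2" by simp
  assume m: "even m" "m < n" "m \<notin> P"
  \<comment> \<open>\<open>f\<close> numbers the pairs with \<open>m\<close> skipped, so that beyond
    \<open>m\<close> they begin at odd positions.\<close>
  define f where "f p = (if p < m then p div 2 else (p - 1) div 2)" for p
  obtain c where c: "m = 2 * c" using m(1) by auto
  have side: "f k < c \<longleftrightarrow> k < m" if "k \<noteq> m" for k
  proof (cases "k < m")
    case True
    then show ?thesis using c by (simp add: f_def less_mult_imp_div_less mult.commute)
  next
    case False
    then have "2 * c \<le> k - 1" using that c by linarith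
    then have "c \<le> (k - 1) div 2" using div_le_mono[of "2 * c" "k - 1" 2] by simp
    then show ?thesis using False by (simp add: f_def)
  qed
  have "inj_on f P"
  proof (rule inj_onI)
    fix p q assume pq: "p \<in> P" "q \<in> P" "f p = f q"
    have ne: "p \<noteq> m" "q \<noteq> m" using m(3) pq by auto
    have iff: "p < m \<longleftrightarrow> q < m" using side[OF ne(1)] side[OF ne(2)] pq(3) by simp
    show "p = q"
    proof (cases "p < m")
      case True
      then show ?thesis using iff pq eq by (simp add: f_def)
    next
      case False
      then obtain p' q' where "p = Suc p'" "q = Suc q'"
        using iff ne by (metis not0_implies_Suc not_less0 linorder_neqE_nat)
      then have "p = q \<or> q = Suc p \<or> p = Suc q"
        using False iff pq(3) half[of p' q'] by (simp add: f_def)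
      then show ?thesis using sparse pq by blast
    qed
  qed
  then have "card P = card (f ` P)" by (simp add: card_image)
  also have "\<dots> \<le> card {..<n div 2}"
  proof (rule card_mono)
    show "f ` P \<subseteq> {..<n div 2}"
    proof
      fix k assume "k \<in> f ` P"
      then obtain p where p: "p \<in> P" "k = f p" by auto
      have "p < n" "p \<noteq> m" using p P m by auto
      have "k < n div 2"
      proof (cases "p < m")
        case True
        then have "k < c" using side[OF \<open>p \<noteq> m\<close>] p by simp
        moreover have "c \<le> n div 2" using div_le_mono[of m n 2] m(2) c by simp
        ultimately show ?thesis by simp
      next
        case False
        then obtain r where r: "p = Suc r" using \<open>p \<noteq> m\<close> by (cases p) auto
        have "Suc (Suc r) \<le> n" using r \<open>p < n\<close> by simp
        then have "Suc (Suc r) div 2 \<le> n div 2" by (rule div_le_mono)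
        then show ?thesis using p r False by (simp add: f_def)
      qed
      then show "k \<in> {..<n div 2}" by simp
    qed
  qed simp
  finally show "card P \<le> n div 2" by simp
qed

lemma card_odd_less: "card {k. k < n \<and> odd (k::nat)} = n div 2"
proof (induction n)
  case (Suc n)
  have "{k. k < Suc n \<and> odd k} = (if odd n then insert n else id) {k. k < n \<and> odd k}"
    by (auto simp: less_Suc_eq)
  then show ?case using Suc by auto
qed simp

context grid
begin

text \<open>A boustrophedon numbering: successive numbers form a Hamiltonian path along edges of the
  open grid, so it serves all three grids. Its parity is that of the site.\<close>

definition snake :: "nat \<times> nat \<Rightarrow> nat" where
  "snake v = fst v * K + (if even (fst v) then snd v else K - 1 - snd v)"

lemma snake_split:
  assumes "v \<in> sites K L"
  shows "snake v div K = fst v" "snake v mod K = (if even (fst v) then snd v else K - 1 - snd v)"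
  using assms dims(1) by (auto simp: snake_def sites_def)

lemma snake_inj: "inj_on snake (sites K L)"
proof (rule inj_onI)
  fix v w assume v: "v \<in> sites K L" and w: "w \<in> sites K L" and eq: "snake v = snake w"
  have "fst v = fst w" using snake_split(1)[OF v] snake_split(1)[OF w] eq by simp
  moreover have "snd v < K" "snd w < K" using v w by (auto simp: sites_def)
  ultimately have "snd v = snd w"
    using snake_split(2)[OF v] snake_split(2)[OF w] eq by (auto split: if_splits)
  with \<open>fst v = fst w\<close> show "v = w" by (rule prod_eqI)
qed

lemma snake_image: "snake ` sites K L = {..<K * L}"
proof (rule card_subset_eq)
  show "snake ` sites K L \<subseteq> {..<K * L}"
  proof
    fix k assume "k \<in> snake ` sites K L"
    then obtain v where v: "v \<in> sites K L" "k = snake v" by auto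
    then have "k div K < L" using snake_split(1)[OF v(1)] by (auto simp: sites_def)
    then show "k \<in> {..<K * L}" using dims(1) by (simp add: div_less_iff_less_mult mult.commute)
  qed
  show "card (snake ` sites K L) = card {..<K * L}"
    using card_image[OF snake_inj] by (simp add: sites_eq mult.commute)
qed simp

lemma snake_parity:
  assumes "v \<in> sites K L"
  shows "even (snake v) \<longleftrightarrow> even_site v"
proof (cases "even (fst v)")
  case False
  have "snd v + 1 \<le> K" using assms by (auto simp: sites_def)
  then obtain c where c: "K = snd v + 1 + c" by (metis le_iff_add)
  then have "K - 1 - snd v = c" by simp
  then have "snake v = fst v * K + c" unfolding snake_def using False by simp
  then show ?thesis using False c unfolding even_site_def by (simp only: even_add even_mult_iff) auto
qed (simp add: snake_def even_site_def)

lemma snake_Suc_adj: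
  assumes v: "v \<in> sites K L" and w: "w \<in> sites K L" and eq: "snake w = Suc (snake v)"
  shows "adj g K L v w"
proof -
  have K: "snd v < K" "snd w < K" using v w by (auto simp: sites_def)
  have "open_adj v w"
  proof (cases "Suc (snake v mod K) = K")
    case True
    then have "snake w div K = Suc (snake v div K)" "snake w mod K = 0"
      unfolding eq by (simp_all add: div_Suc mod_Suc)
    then have "fst w = Suc (fst v)" "(if even (fst w) then snd w else K - 1 - snd w) = 0"
        "Suc (if even (fst v) then snd v else K - 1 - snd v) = K"
      using snake_split[OF v] snake_split[OF w] True by simp_all
    then show ?thesis using K by (auto simp: open_adj_def split: if_splits)
  next
    case False
    then have "snake w div K = snake v div K" "snake w mod K = Suc (snake v mod K)"
      unfolding eq by (simp_all add: div_Suc mod_Suc)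
    then have "fst w = fst v" "(if even (fst w) then snd w else K - 1 - snd w) =
        Suc (if even (fst v) then snd v else K - 1 - snd v)"
      using snake_split[OF v] snake_split[OF w] by simp_all
    then show ?thesis using K by (auto simp: open_adj_def split: if_splits)
  qed
  then show ?thesis by (cases g) auto
qed

lemma card_Bl: "card Bl = (K * L) div 2"
proof -
  have "snake ` Bl = {k. k < K * L \<and> odd k}"
  proof (intro equalityI subsetI)
    fix k assume "k \<in> snake ` Bl"
    then show "k \<in> {k. k < K * L \<and> odd k}" using snake_image snake_parity by (auto simp: Bl_def)
  next
    fix k assume k: "k \<in> {k. k < K * L \<and> odd k}"
    then have "k \<in> snake ` sites K L" using snake_image by simp
    then obtain v where "v \<in> sites K L" "k = snake v" by blast
    then show "k \<in> snake ` Bl" using k snake_parity by (auto simp: Bl_def)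
  qed
  moreover have "inj_on snake Bl" by (rule inj_on_subset[OF snake_inj]) (auto simp: Bl_def)
  ultimately show ?thesis using card_image[of snake Bl] card_odd_less[of "K * L"] by simp
qed

lemma card_Wh: "card Wh = Suc (K * L) div 2"
proof -
  have "card (sites K L) = card Wh + card Bl"
  proof -
    have "sites K L = Wh \<union> Bl" "Wh \<inter> Bl = {}" unfolding Wh_def Bl_def by blast+
    then show ?thesis using finite_V card_Un_disjoint[of Wh Bl] by (metis finite_Un)
  qed
  moreover have "card (sites K L) = K * L" by (simp add: sites_eq)
  ultimately show ?thesis using card_Bl by linarith
qed

text \<open>Along the snake an independent set has no two consecutive positions. If it differs from
  \<open>Wh\<close>, it misses some even site: on top of all of \<open>Wh\<close>, any odd particle
  would touch an even one.\<close>

lemma indep_card_le: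
  assumes S: "S \<in> indep"
  shows "card S \<le> card Wh" and "S \<noteq> Wh \<Longrightarrow> card S \<le> card Bl"
proof -
  have SV: "S \<subseteq> sites K L" using S by (simp add: indep_def)
  have sub: "snake ` S \<subseteq> {..<K * L}" using SV snake_image by blast
  have sparse: "Suc k \<notin> snake ` S" if k: "k \<in> snake ` S" for k
  proof
    assume "Suc k \<in> snake ` S"
    then obtain v w where vw: "v \<in> S" "k = snake v" "w \<in> S" "Suc k = snake w"
      using k by blast
    then have "adj g K L v w" using SV by (intro snake_Suc_adj) auto
    then show False using S vw unfolding indep_def by blast
  qed
  have card: "card (snake ` S) = card S"
    by (rule card_image[OF inj_on_subset[OF snake_inj SV]])
  show "card S \<le> card Wh"
    using sparse_card(1)[OF sub sparse] by (simp add: card card_Wh)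
  assume "S \<noteq> Wh"
  have "\<not> Wh \<subseteq> S"
  proof
    assume Wh: "Wh \<subseteq> S"
    then obtain b where b: "b \<in> S" "b \<notin> Wh" using \<open>S \<noteq> Wh\<close> by blast
    then have "b \<in> sites K L" using SV by blast
    then have "0 < card {w \<in> sites K L. adj g K L b w}" using degree[of b] by linarith
    then have "{w \<in> sites K L. adj g K L b w} \<noteq> {}" by (metis card.empty less_irrefl)
    then obtain w where w: "w \<in> sites K L" "adj g K L b w" by blast
    then have "w \<in> Wh" using adj_white[of b w] b SV by (auto simp: Wh_def)
    then show False using w b S Wh by (auto simp: indep_def)
  qed
  then obtain v where v: "v \<in> sites K L" "even_site v" "v \<notin> S" by (auto simp: Wh_def)
  have "snake v \<notin> snake ` S"
    using v SV snake_inj by (meson inj_on_image_mem_iff)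
  moreover have "snake v < K * L" using v snake_image by blast
  ultimately show "card S \<le> card Bl"
    using sparse_card(2)[OF sub sparse] snake_parity[OF v(1)] v(2) by (simp add: card card_Bl)
qed

section \<open>The hard-core chain and its barrier\<close>

lemma metropolis_hc: "0 < \<beta> \<Longrightarrow>
  metropolis indep flip (\<lambda>S. - real (card S)) (real (K * L)) \<beta> (hc_P g K L \<beta>)"
proof
  assume b: "0 < \<beta>"
  show "finite indep" by (rule finite_indep)
  show "0 < real (K * L)" using dims by simp
  show "0 \<le> \<beta>" using b by simp
  show "flip T S" if "flip S T" for S T using that by (simp add: flip_def Un_commute)
  show "hc_P g K L \<beta> S T =
      (if flip S T then exp (- \<beta> * max 0 (- real (card T) - - real (card S))) / real (K * L) else 0)"
    if "S \<noteq> T" for S T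
    using that by (simp add: hc_P_def hc_Poff_def hc_q_def hc_H_def flip_def)
  show "hc_P g K L \<beta> S S = 1 - (\<Sum>T\<in>indep - {S}. hc_P g K L \<beta> S T)" for S
    unfolding hc_P_def[of _ _ _ _ S S] indep_eq by (auto simp: hc_P_def intro!: sum.cong)
  show "real (card {T \<in> indep - {S}. flip S T}) \<le> real (K * L)" if S: "S \<in> indep" for S
  proof -
    have "{T \<in> indep - {S}. flip S T} \<subseteq> (\<lambda>v. if v \<in> S then S - {v} else insert v S) ` sites K L"
    proof
      fix T assume "T \<in> {T \<in> indep - {S}. flip S T}"
      then have T: "T \<in> indep" "flip S T" by auto
      from T(2) show "T \<in> (\<lambda>v. if v \<in> S then S - {v} else insert v S) ` sites K L"
        by (cases rule: flipE) (use T(1) S in \<open>auto simp: indep_def image_iff\<close>)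
    qed
    then have "card {T \<in> indep - {S}. flip S T} \<le> card (sites K L)"
      using finite_V by (meson card_image_le card_mono finite_imageI le_trans)
    moreover have "card (sites K L) = K * L" by (simp add: sites_eq)
    ultimately show ?thesis by (simp only: of_nat_le_iff)
  qed
qed

lemma origin_in_Wh: "(0, 0) \<in> Wh"
proof -
  have "(0, 0) \<in> sites K L" "even_site (0, 0)" using dims by (auto simp: sites_def even_site_def)
  then show ?thesis unfolding Wh_def by blast
qed

lemma Wh_neq_Bl: "Wh \<noteq> Bl"
  using origin_in_Wh by (auto simp: Wh_def Bl_def)

text \<open>The path through the empty configuration shows that some level is feasible, and
  \<open>reach_Bl_stays\<close> excludes levels within \<open>depth\<close> of
  \<open>card Bl\<close>.\<close>

lemma exists_barrier:
  obtains m :: nat where "reach (real m) Bl Wh" "\<And>k. m < k \<Longrightarrow> \<not> reach (real k) Bl Wh"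
    "m + depth < card Bl"
proof -
  have ex: "reach (real 0) Bl Wh"
    using reach_empty[OF Bl_indep] reach_sym[OF reach_empty[OF Wh_indep]] by simp
  \<comment> \<open>The ends differ, so there is a first step, and its level bounds \<open>k\<close>
    by the size of its starting point \<open>Bl\<close>.\<close>
  have bound: "k \<le> card Bl" if "reach (real k) Bl Wh" for k
    using that Wh_neq_Bl by (cases rule: converse_rtranclpE) (auto simp: level_step_def)
  define m where "m = (GREATEST k. reach (real k) Bl Wh)"
  have m: "reach (real m) Bl Wh" "\<And>k. reach (real k) Bl Wh \<Longrightarrow> k \<le> m"
    unfolding m_def using GreatestI_nat[of "\<lambda>k. reach (real k) Bl Wh"]
      Greatest_le_nat[of "\<lambda>k. reach (real k) Bl Wh"] ex bound by blast+
  have "\<not> reach (real (card Bl) - real depth) Bl Wh"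
  proof
    assume r: "reach (real (card Bl) - real depth) Bl Wh"
    have "depth < card {w \<in> Bl. adj g K L v w}" if "v \<in> Wh" for v
    proof -
      have "{w \<in> sites K L. adj g K L v w} \<subseteq> {w \<in> Bl. adj g K L v w}"
        using that adj_white unfolding Wh_def Bl_def by blast
      moreover have "finite {w \<in> Bl. adj g K L v w}" using finite_V by (simp add: Bl_def)
      ultimately have "card {w \<in> sites K L. adj g K L v w} \<le> card {w \<in> Bl. adj g K L v w}"
        by (rule card_mono[rotated])
      then show ?thesis using degree[of v] that by (simp add: Wh_def)
    qed
    then have "Wh \<subseteq> Bl" using reach_Bl_stays r by blast
    then show False using origin_in_Wh by (auto simp: Wh_def Bl_def)
  qed
  then have "\<not> real (card Bl) - real depth \<le> real m" using m(1) reach_weaken by blast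
  then have "m + depth < card Bl" by linarith
  with m show thesis using that by (metis leD)
qed

text \<open>Both directions share the saddle level \<open>m\<close>. Other wells have depth at most
  \<open>depth\<close>, hence at most \<open>card x - m - 1\<close>, which allows
  \<open>\<delta> = 1\<close>.\<close>

lemma metastable_from:
  assumes m: "reach (real m) Bl Wh" "\<And>k. m < k \<Longrightarrow> \<not> reach (real k) Bl Wh"
      "m + depth < card Bl"
    and xy: "x = Wh \<and> y = Bl \<or> x = Bl \<and> y = Wh"
  shows "metastable_props (hc_P g K L) indep x y (real (card x) - real m)"
proof (rule metastable_props_of_levels[where \<delta> = 1 and E = flip
      and H = "\<lambda>S. - real (card S)" and N = "real (K * L)"])
  have le: "card Bl \<le> card Wh" using indep_card_le(1)[OF Bl_indep] .
  have x: "m + depth < card x" using m(3) xy le by auto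
  show "metropolis indep flip (\<lambda>S. - real (card S)) (real (K * L)) \<beta> (hc_P g K L \<beta>)"
    if "0 < \<beta>" for \<beta> by (rule metropolis_hc[OF that])
  show "x \<in> indep" "y \<in> indep" using xy Wh_indep Bl_indep by auto
  show "x \<noteq> y" using xy Wh_neq_Bl by auto
  show "(0::real) < 1" by simp
  show "1 \<le> real (card x) - real m" using x by linarith
  show "- real (card x) \<le> - real (card z)" if "z \<in> indep - {y}" for z
    using indep_card_le[of z] that xy by auto
  show "\<exists>a\<in>{x, y}. level_path indep flip (\<lambda>S. - real (card S))
      (- real (card z) + (real (card x) - real m) - 1) z a" if "z \<in> indep - {x, y}" for z
  proof -
    have "z \<in> indep" using that by simp
    then obtain a where "a \<in> {Wh, Bl}" "reach (real (card z) - real depth) z a"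
      using reach_ground[of depth z] not_trapped by blast
    moreover from this(2) have "level_path indep flip (\<lambda>S. - real (card S))
        (- real (card z) + (real (card x) - real m) - 1) z a"
      by (rule level_path_mono[rotated]) (use x in linarith)
    ultimately show ?thesis using xy by auto
  qed
  have "reach (real m) x y" using xy m(1) reach_sym[OF m(1)] by auto
  then show "level_path indep flip (\<lambda>S. - real (card S))
      (- real (card x) + (real (card x) - real m)) x y" by simp
  show "\<not> level_path indep flip (\<lambda>S. - real (card S)) h x y"
    if h: "h < - real (card x) + (real (card x) - real m)" for h
  proof
    assume "level_path indep flip (\<lambda>S. - real (card S)) h x y"
    \<comment> \<open>Particle numbers are integers: strictly more than \<open>m\<close> means at
      least \<open>Suc m\<close>, so a real level reduces to an integer one.\<close>
    moreover have "- real (card S) \<le> - real (Suc m)" if "- real (card S) \<le> h"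
      for S :: "(nat \<times> nat) set"
    proof -
      have "real m < real (card S)" using h that by linarith
      then show ?thesis by simp
    qed
    ultimately have "reach (real (Suc m)) x y"
      by (elim rtranclp_mono[THEN predicate2D, rotated]) (unfold level_step_def, blast)
    then have "reach (real (Suc m)) Bl Wh" using xy reach_sym by blast
    then show False using m(2)[of "Suc m"] by blast
  qed
qed

end

theorem theorem2p1:
  fixes g :: grid_kind and K L :: nat
  assumes "valid_grid g K L"
  shows "\<exists>Gam > 0.
     metastable_props (hc_P g K L) (hc_states g K L) (conf_e K L) (conf_o K L) Gam \<and>
     (g = OpenGrid \<and> odd (K * L) \<longrightarrow>
        metastable_props (hc_P g K L) (hc_states g K L) (conf_o K L) (conf_e K L) (Gam - 1))"
proof -
  interpret grid g K L by (rule grid.intro) fact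
  obtain m :: nat where m: "reach (real m) Bl Wh" "\<And>k. m < k \<Longrightarrow> \<not> reach (real k) Bl Wh"
    "m + depth < card Bl"
    by (rule exists_barrier) blast
  let ?Gam = "real (card Wh) - real m"
  have "card Bl \<le> card Wh" using indep_card_le(1)[OF Bl_indep] .
  then have "0 < ?Gam" using m(3) by linarith
  moreover have "metastable_props (hc_P g K L) indep Wh Bl ?Gam"
    by (rule metastable_from[OF m]) simp_all
  moreover have "metastable_props (hc_P g K L) indep Bl Wh (?Gam - 1)" if "odd (K * L)"
  proof -
    have "card Wh = Suc (card Bl)" using that by (simp add: card_Wh card_Bl)
    then have Gam: "?Gam - 1 = real (card Bl) - real m" by simp
    show ?thesis unfolding Gam by (rule metastable_from[OF m]) simp_all
  qed
  ultimately show ?thesis unfolding Wh_eq Bl_eq indep_eq by blast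
qed

end
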